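(* Let $\gamma=\frac{1+\sqrt5}2$ and $T:[0,1)^2\to[0,1)^2$, $T(x,y)=(y,\{-x-y/\gamma\})$ (the map associated with $\lambda=-\gamma$). Then $\pi(z)$ is finite for all $z\in(\mathbb Z[\gamma]\cap[0,1))^2$, but $\pi\left(1-\frac1{3\gamma^2},1-\frac1{3\gamma^5}\right)=\infty$.
   Context: $\{u\}=u-\lfloor u\rfloor$ is the fractional part. $T$ is a bijection of $[0,1)^2$. $\pi(z)$ is the least $p\ge1$ with $T^p(z)=z$, and $\pi(z)=\infty$ if no such $p$ exists. *)

theory Defs
  imports Complex_Main "HOL-Library.Extended_Nat" "HOL-Library.FuncSet" "HOL-Computational_Algebra.Polynomial"
begin

definition golden_ratio :: real where
  "golden_ratio = (1 + sqrt 5) / 2"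

definition int_adjoin :: "real \<Rightarrow> real set" where
  "int_adjoin a = range (\<lambda>p :: int poly. poly (map_poly of_int p) a)"

definition T_map :: "real \<times> real \<Rightarrow> real \<times> real" where
  "T_map = (\<lambda>(x, y). (y, frac (- x - y / golden_ratio)))"

definition min_period :: "('a \<Rightarrow> 'a) \<Rightarrow> 'a \<Rightarrow> enat" where
  "min_period f z =
     (if \<exists>p\<ge>1. (f ^^ p) z = z then enat (LEAST p. p \<ge> 1 \<and> (f ^^ p) z = z) else \<infinity>)"

text \<open>\<^const>\<open>T_map\<close> is total on the plane; the map of interest is its restriction to
  the half-open unit square, which is invariant and on which it is a bijection.\<close>

lemma T_map_bij_betw: "bij_betw T_map ({0..<1} \<times> {0..<1}) ({0..<1} \<times> {0..<1})"
proof (rule bij_betwI)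
  let ?g = golden_ratio
  define S where "S = (\<lambda>(x :: real, y :: real). (frac (- y - x / ?g), x))"
  show "T_map \<in> {0..<1} \<times> {0..<1} \<rightarrow> {0..<1} \<times> {0..<1}"
    by (auto simp: T_map_def frac_lt_1)
  show "S \<in> {0..<1} \<times> {0..<1} \<rightarrow> {0..<1} \<times> {0..<1}"
    by (auto simp: S_def frac_lt_1)
  have *: "frac (- frac (- a - b) - b) = a" if "0 \<le> a" "a < 1" for a b :: real
  proof -
    have "- frac (- a - b) - b = a + of_int \<lfloor>- a - b\<rfloor>"
      by (simp add: frac_def)
    then show ?thesis
      using that by (simp add: frac_def floor_eq_iff)
  qed
  show "S (T_map z) = z" if "z \<in> {0..<1} \<times> {0..<1}" for z
    using that by (auto simp: T_map_def S_def *)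
  show "T_map (S z) = z" if "z \<in> {0..<1} \<times> {0..<1}" for z
    using that by (auto simp: T_map_def S_def *)
qed

end

theory Submission
  imports Defs
begin

text \<open>The linear part of the map is a rotation of order ten for a suitable quadratic form, so away from
the origin the map exchanges two convex pieces, turning the piece \<open>x + y/g \<le> 1\<close> about one centre
and the piece \<open>x + y/g > 1\<close> about another. A point that stays in one piece for ever is therefore
periodic. This remark is used at every level: an orbit is either periodic or sees both pieces, and
seeing both pieces forces it into a smaller region, where the dynamics is accelerated.

Three accelerations suffice. The first is the return to the set of points that have just crossed
from the upper piece into the lower one, which is a truncated cone with apex \<open>(0, 1)\<close>, called the
wedge (\<open>wedge_return_correct\<close>). Every wedge point is periodic or reaches the tip of the cone
(\<open>wedge_settles\<close>). The second is the return to the tip: rescaled by \<open>g^3\<close>, it is an exchange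
\<open>tri_map\<close> of two triangles, each rotated by a multiple of a fifth of a full turn
(\<open>tri_map_correct\<close>). The third is self-similarity: shrinking the triangle by \<open>g^2\<close> towards its apex
conjugates \<open>tri_map\<close> to an acceleration of itself (\<open>tri_map_self_similar\<close>). Again every point is
periodic or reaches the shrunken triangle, so it can be renormalized by expanding it by \<open>g^2\<close>.

For a point with coordinates in \<open>\<int>[g]\<close> apply the nontrivial field automorphism \<open>g \<mapsto> 1 - g\<close>. The
conjugated pieces of \<open>tri_map\<close> are again rotations of a plane, so the steps between two
renormalizations lengthen the conjugate by a bounded amount, while the expansion by \<open>g^2\<close> becomes a
contraction by \<open>g^-2\<close>. If the point were never periodic, its conjugates would shrink until they
violated the lower bound that holds because a small nonzero element of \<open>\<int>[g]\<close> has a large conjugate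
(\<open>conj_of_far\<close>, \<open>renormalization\<close>, \<open>tri_eventually_periodic\<close>).

The coordinates of the exceptional point lie in \<open>\<int>[g]/3\<close>, where that lower bound fails. Its
renormalizations run through a cycle of four points for ever, so its orbit comes arbitrarily close
to the apex without reaching it. The orbit is infinite and the point is not periodic.\<close>

section \<open>Arithmetic of the golden ratio\<close>

abbreviation g :: real where "g \<equiv> golden_ratio"

lemma golden_square: "g * g = g + 1"
  unfolding golden_ratio_def by (simp add: field_simps)

lemma golden_square_left: "g * (g * z) = g * z + z" for z
  using golden_square by (metis distrib_right mult.assoc mult_1)

lemma golden_bounds: "1618 / 1000 < g" "g < 16181 / 10000"
proof -
  have "sqrt 5 > 2.236" by (rule real_less_rsqrt) (simp add: power2_eq_square)
  moreover have "sqrt 5 < 2.2362" by (rule real_less_lsqrt) (simp_all add: power2_eq_square)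
  ultimately show "1618 / 1000 < g" "g < 16181 / 10000" unfolding golden_ratio_def by simp_all
qed

lemma golden_inverse: "(g - 1) * g = 1"
  by (simp add: left_diff_distrib golden_square)

lemma divide_golden: "x / g = (g - 1) * x"
proof -
  have "inverse g = g - 1" by (metis golden_inverse inverse_unique mult.commute)
  then show ?thesis by (simp add: divide_inverse mult.commute)
qed

text \<open>These rules turn a polynomial in \<open>g\<close> and real variables \<open>u\<close>, \<open>y\<close> into a rational linear combination of
products free of \<open>g\<^sup>2\<close>. Linear arithmetic then treats \<open>g\<close>, \<open>g * u\<close>, \<open>g * y\<close> as independent unknowns.\<close>

lemmas golden_norm = distrib_left distrib_right left_diff_distrib right_diff_distrib
  golden_square golden_square_left mult.assoc mult.commute
    mult.left_commute mult_1_left mult_1_right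
  mult_minus_left mult_minus_right minus_add_distrib minus_diff_eq minus_minus
  mult_zero_left mult_zero_right

text \<open>A linear inequality over \<open>\<rat>(g)\<close> is a combination of the hypotheses with coefficients in \<open>\<rat>(g)\<close>, whereas
linear arithmetic only finds rational coefficients. It therefore gets the hypotheses multiplied
beforehand by suitable powers of \<open>g\<close>. The factors below are \<open>g\<close>, \<open>g^-1\<close>, \<open>g^-2\<close>, \<open>g^-3\<close> and \<open>g^-4\<close>.\<close>

lemma golden_less:
  fixes a b :: real assumes "a < b"
  shows "g * a < g * b" "(g - 1) * a < (g - 1) * b" "(2 - g) * a < (2 - g) * b"
    "(2 * g - 3) * a < (2 * g - 3) * b" "(5 - 3 * g) * a < (5 - 3 * g) * b"
  using assms golden_bounds by simp_all

lemma golden_le: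
  fixes a b :: real assumes "a \<le> b"
  shows "g * a \<le> g * b" "(g - 1) * a \<le> (g - 1) * b" "(2 - g) * a \<le> (2 - g) * b"
    "(2 * g - 3) * a \<le> (2 * g - 3) * b"
  using assms golden_bounds by simp_all


section \<open>Eventual periodicity and accelerated dynamics\<close>

definition eventually_periodic :: "('a \<Rightarrow> 'a) \<Rightarrow> 'a \<Rightarrow> bool" where
  "eventually_periodic f z \<longleftrightarrow> (\<exists>k m. m \<ge> 1 \<and> (f ^^ (m + k)) z = (f ^^ k) z)"

lemma eventually_periodicI: "m \<ge> 1 \<Longrightarrow> (f ^^ m) z = z \<Longrightarrow> eventually_periodic f z"
  unfolding eventually_periodic_def by (rule exI[of _ 0]) auto

lemma eventually_periodic_before:
  assumes "eventually_periodic f ((f ^^ n) z)"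
  shows "eventually_periodic f z"
proof -
  obtain k m where "m \<ge> 1" and "(f ^^ (m + k)) ((f ^^ n) z) = (f ^^ k) ((f ^^ n) z)"
    using assms unfolding eventually_periodic_def by blast
  then have "(f ^^ (m + (k + n))) z = (f ^^ (k + n)) z"
    by (simp add: funpow_add)
  with \<open>m \<ge> 1\<close> show ?thesis unfolding eventually_periodic_def by blast
qed

lemma funpow_trans: "(f ^^ m) x = y \<Longrightarrow> (f ^^ n) y = z \<Longrightarrow> (f ^^ (m + n)) x = z"
  by (metis add.commute comp_apply funpow_add)

lemma funpow_unroll:
  "(f ^^ 1) z = f z" "(f ^^ 2) z = f (f z)" "(f ^^ 3) z = f (f (f z))"
    "(f ^^ 4) z = f (f (f (f z)))"
  "(f ^^ 5) z = f (f (f (f (f z))))" "(f ^^ 6) z = f (f (f (f (f (f z)))))"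
  by (simp_all add: eval_nat_numeral)

text \<open>Through the coding \<open>\<phi>\<close>, one step of \<open>h\<close> is a positive but otherwise unspecified number of steps of
\<open>f\<close>. First-return maps are of this kind, and so is the self-similarity of \<open>tri_map\<close>.\<close>

definition speeds_up :: "('b \<Rightarrow> 'b) \<Rightarrow> 'b set \<Rightarrow> ('a \<Rightarrow> 'a) \<Rightarrow> ('b \<Rightarrow> 'a) \<Rightarrow> bool" where
  "speeds_up h S f \<phi> \<longleftrightarrow> (\<forall>z\<in>S. h z \<in> S \<and> (\<exists>n\<ge>1. (f ^^ n) (\<phi> z) = \<phi> (h z)))"

lemma speeds_up_iterate:
  assumes "speeds_up h S f \<phi>" "z \<in> S"
  shows "(h ^^ m) z \<in> S \<and> (\<exists>n\<ge>m. (f ^^ n) (\<phi> z) = \<phi> ((h ^^ m) z))"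
proof (induction m)
  case 0
  show ?case using assms(2) by (auto intro: exI[of _ 0])
next
  case (Suc m)
  then obtain n where n: "(h ^^ m) z \<in> S" "n \<ge> m" "(f ^^ n) (\<phi> z) = \<phi> ((h ^^ m) z)" by blast
  obtain n' where n': "n' \<ge> 1" "(f ^^ n') (\<phi> ((h ^^ m) z)) = \<phi> (h ((h ^^ m) z))"
    and "h ((h ^^ m) z) \<in> S"
    using assms(1) n(1) unfolding speeds_up_def by blast
  then show ?case
    using funpow_trans[OF n(3) n'(2)] n(2) n'(1) by (auto intro!: exI[of _ "n + n'"])
qed

text \<open>A cycle of the accelerated map unfolds to a cycle of the original one, since every accelerated step
takes at least one step.\<close>

lemma speeds_up_eventually_periodic:
  assumes h: "speeds_up h S f \<phi>" and z: "z \<in> S" and "eventually_periodic h z"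
  shows "eventually_periodic f (\<phi> z)"
proof -
  obtain k m where m: "m \<ge> 1" "(h ^^ (m + k)) z = (h ^^ k) z"
    using assms(3) unfolding eventually_periodic_def by blast
  let ?w = "(h ^^ k) z"
  obtain n where n: "?w \<in> S" "(f ^^ n) (\<phi> z) = \<phi> ?w"
    using speeds_up_iterate[OF h z] by blast
  have "(h ^^ m) ?w = ?w" using m(2) by (simp add: funpow_add)
  then obtain n' where "n' \<ge> m" "(f ^^ n') (\<phi> ?w) = \<phi> ?w"
    using speeds_up_iterate[OF h n(1), of m] by auto
  then have "eventually_periodic f ((f ^^ n) (\<phi> z))"
    using m(1) n(2) by (auto intro: eventually_periodicI[of n'])
  then show ?thesis by (rule eventually_periodic_before)
qed

text \<open>As long as the orbit stays in \<open>S\<close> it follows the map \<open>h\<close> of finite order, so an orbit that never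
leaves closes up. The exit time also records that the orbit up to there is an orbit of \<open>h\<close>, which
is what later bounds the conjugate.\<close>

lemma cycle_or_exit:
  assumes eq: "\<And>w. w \<in> S \<Longrightarrow> f w = h w" and order: "(h ^^ n) z = z" "n \<ge> 1" and "z \<in> S"
  shows "eventually_periodic f z \<or>
    (\<exists>k. (f ^^ k) z = (h ^^ k) z \<and> (f ^^ k) z \<in> S \<and> (f ^^ Suc k) z \<notin> S)"
proof (cases "\<forall>k. (f ^^ k) z \<in> S")
  case True
  have "(f ^^ k) z = (h ^^ k) z" for k
  proof (induction k)
    case (Suc k)
    have "f ((f ^^ k) z) = h ((f ^^ k) z)" using True by (intro eq) blast
    then show ?case using Suc by simp
  qed simp
  then show ?thesis using order by (auto intro: eventually_periodicI[of n])
next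
  case False
  define j where "j = (LEAST k. (f ^^ k) z \<notin> S)"
  have j: "(f ^^ j) z \<notin> S"
    using False unfolding j_def by (metis (mono_tags, lifting) LeastI)
  have before: "(f ^^ i) z \<in> S" if "i < j" for i
    using not_less_Least that unfolding j_def by blast
  obtain k where k: "j = Suc k" using j \<open>z \<in> S\<close> by (cases j) auto
  have "i \<le> k \<Longrightarrow> (f ^^ i) z = (h ^^ i) z" for i
  proof (induction i)
    case (Suc i)
    then show ?case using before[of i] eq[of "(f ^^ i) z"] k by simp
  qed simp
  then show ?thesis using j before[of k] k by blast
qed


section \<open>The map as a pair of rotations of order ten\<close>

definition turn :: "real \<Rightarrow> real \<times> real \<Rightarrow> real \<times> real" where
  "turn b = (\<lambda>(x, y). (y, b - x - (g - 1) * y))"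

text \<open>In coordinates centred at the fixed point \<open>((2 - g) * b, (2 - g) * b)\<close> the map is linear of trace
\<open>1 - g = 2 cos (3 \<pi> / 5)\<close>, a rotation by three tenths of a full turn. Five of them make a half-turn.\<close>

lemma turn_half: "(turn b ^^ 5) (x, y) = (2 * (2 - g) * b - x, 2 * (2 - g) * b - y)"
proof -
  let ?x2 = "b - x - (g - 1) * y" and ?x3 = "(2 - g) * b + (g - 1) * (x - y)"
  let ?x4 = "(g - 1) * x + y - (2 * g - 3) * b"
  let ?x5 = "2 * (2 - g) * b - x" and ?x6 = "2 * (2 - g) * b - y"
  have "turn b (x, y) = (y, ?x2)" by (simp add: turn_def)
  moreover have "turn b (y, ?x2) = (?x2, ?x3)" by (simp only: turn_def prod.case golden_norm) simp
  moreover have "turn b (?x2, ?x3) = (?x3, ?x4)" by (simp only: turn_def prod.case golden_norm) simp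
  moreover have "turn b (?x3, ?x4) = (?x4, ?x5)" by (simp only: turn_def prod.case golden_norm) simp
  moreover have "turn b (?x4, ?x5) = (?x5, ?x6)" by (simp only: turn_def prod.case golden_norm) simp
  ultimately show ?thesis by (simp only: funpow_unroll)
qed

lemma turn_order: "(turn b ^^ 10) z = z"
proof (cases z)
  case (Pair x y)
  have "(turn b ^^ (5 + 5)) (x, y) = (x, y)"
    by (rule funpow_trans[OF turn_half]) (simp add: turn_half)
  then show ?thesis using Pair by simp
qed

text \<open>The fractional part subtracts an integer, and \<open>b\<close> is the right one as soon as the new coordinate
lands in the unit interval. Following an itinerary thus only needs the coordinates to be in range.\<close>

lemma T_step:
  assumes "b \<in> \<int>" "0 \<le> b - x - (g - 1) * y" "b - x - (g - 1) * y < 1"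
  shows "T_map (x, y) = (y, b - x - (g - 1) * y)"
proof -
  have "- x - y / g - (b - x - (g - 1) * y) \<in> \<int>"
    using Ints_minus[OF assms(1)] by (simp add: divide_golden)
  then have "frac (- x - y / g) = b - x - (g - 1) * y"
    using assms by (simp add: frac_unique_iff)
  then show ?thesis by (simp add: T_map_def)
qed

lemma T_rotation1:
  assumes "b \<in> \<int>" "0 \<le> q" "q < 1" "q = b - x - (g - 1) * y"
  shows "(T_map ^^ 1) (x, y) = (y, q)"
  using T_step[of b x y] assms by simp

text \<open>Four consecutive steps with the same \<open>b\<close>. The hypotheses bound the four coordinates that are
produced one after the other; \<open>p\<close> and \<open>q\<close> are the last two of them.\<close>

lemma T_rotation4:
  fixes b x y :: real
  defines "c \<equiv> (2 - g) * b"
  assumes b: "b \<in> \<int>"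
    and "0 \<le> b - x - (g - 1) * y" "b - x - (g - 1) * y < 1"
    and "0 \<le> c + (g - 1) * (x - y)" "c + (g - 1) * (x - y) < 1"
    and "0 \<le> (g - 1) * x + y - (2 * g - 3) * b" "(g - 1) * x + y - (2 * g - 3) * b < 1"
    and "0 \<le> 2 * c - x" "2 * c - x < 1"
    and "p = (g - 1) * x + y - (2 * g - 3) * b" "q = 2 * c - x"
  shows "(T_map ^^ 4) (x, y) = (p, q)"
proof -
  let ?x2 = "b - x - (g - 1) * y" and ?x3 = "c + (g - 1) * (x - y)"
  have 3: "b - y - (g - 1) * ?x2 = ?x3" unfolding c_def by (simp only: golden_norm)
  have 4: "b - ?x2 - (g - 1) * ?x3 = p" unfolding c_def assms(11) by (simp only: golden_norm)
  have 5: "b - ?x3 - (g - 1) * p = q" unfolding c_def assms(11,12) by (simp only: golden_norm)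
  have "T_map (x, y) = (y, ?x2)" using assms by (intro T_step)
  moreover have "T_map (y, ?x2) = (?x2, ?x3)" using T_step[of b y ?x2] assms unfolding 3 by blast
  moreover have "T_map (?x2, ?x3) = (?x3, p)" using T_step[of b ?x2 ?x3] assms unfolding 4 by blast
  moreover have "T_map (?x3, p) = (p, q)" using T_step[of b ?x3 p] assms unfolding 5 by blast
  ultimately show ?thesis by (simp add: eval_nat_numeral)
qed

text \<open>After five steps the rotation is a half-turn, so the last coordinates are the reflections
\<open>2 * c - t\<close> of earlier ones.\<close>

lemma T_rotation7:
  fixes b x y :: real
  defines "c \<equiv> (2 - g) * b"
  assumes b: "b \<in> \<int>"
    and "0 \<le> b - x - (g - 1) * y" "b - x - (g - 1) * y < 1"
    and "0 \<le> c + (g - 1) * (x - y)" "c + (g - 1) * (x - y) < 1"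
    and "0 \<le> (g - 1) * x + y - (2 * g - 3) * b" "(g - 1) * x + y - (2 * g - 3) * b < 1"
    and "0 \<le> 2 * c - x" "2 * c - x < 1"
    and "0 \<le> 2 * c - y" "2 * c - y < 1"
    and "0 \<le> p" "p < 1" "0 \<le> q" "q < 1"
    and "p = 2 * c - (b - x - (g - 1) * y)" "q = c - (g - 1) * (x - y)"
  shows "(T_map ^^ 7) (x, y) = (p, q)"
proof -
  let ?x4 = "(g - 1) * x + y - (2 * g - 3) * b" and ?x5 = "2 * c - x" and ?x6 = "2 * c - y"
  have 6: "b - ?x4 - (g - 1) * ?x5 = ?x6" unfolding c_def by (simp only: golden_norm)
  have 7: "b - ?x5 - (g - 1) * ?x6 = p" unfolding c_def assms(17) by (simp only: golden_norm)
  have 8: "b - ?x6 - (g - 1) * p = q" unfolding c_def assms(17,18) by (simp only: golden_norm)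
  have "(T_map ^^ 4) (x, y) = (?x4, ?x5)"
    using T_rotation4[of b x y ?x4 ?x5] assms unfolding c_def by blast
  moreover have "T_map (?x4, ?x5) = (?x5, ?x6)"
    using T_step[of b ?x4 ?x5] assms unfolding 6 by blast
  moreover have "T_map (?x5, ?x6) = (?x6, p)" using T_step[of b ?x5 ?x6] assms unfolding 7 by blast
  moreover have "T_map (?x6, p) = (p, q)" using T_step[of b ?x6 p] assms unfolding 8 by blast
  ultimately show ?thesis by (simp add: eval_nat_numeral)
qed

section \<open>First returns to a wedge\<close>

text \<open>In the coordinates of \<open>wedge_point\<close> the apex \<open>(0, 1)\<close> is the origin and its two sides are the lines
\<open>u = 0\<close> and \<open>y = g * u\<close>. Scaling towards the apex is then multiplication by a scalar. The open and
closed sides are inherited from the half-open square and matter for boundary orbits.\<close>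

definition wedge :: "(real \<times> real) set" where
  "wedge = {(u, y). 0 < u \<and> g * u < y \<and> u + y \<le> 1}"

definition wedge_point :: "real \<times> real \<Rightarrow> real \<times> real" where
  "wedge_point = (\<lambda>(u, y). ((g - 1) * y, 1 + (g - 1) * u - (2 - g) * y))"

text \<open>Write 1 and 2 for the two rotations. A wedge point first turns about the lower centre 1, 4 or 7 times
and then about the upper centre 1, 4 or 7 times before it is back in the wedge. The five
combinations that occur define the letters A = 1 2, B = 1111 2, C = 1111 2222, D = 1111111 2222 and
E = 1111111 2222222.\<close>

lemma T_word_A:
  assumes "0 < u" "g * u < y" "u + y \<le> 1" "(g + 1) * y < 1 + g * u"
  shows "(T_map ^^ 2) (wedge_point (u, y)) =
      wedge_point (- u + (g - 1) * y, g - 1 - (g - 1) * u - (g - 1) * y)"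
proof -
  note facts = assms(2) assms(1)[THEN golden_less(1)] assms(3)[THEN golden_le(3)]
    assms(4)[THEN golden_less(4)] golden_bounds
  have s1: "(T_map ^^ 1) ((g - 1) * y, 1 + (g - 1) * u - (2 - g) * y) =
      (1 + (g - 1) * u - (2 - g) * y, 2 - g - (2 - g) * u - (2 - g) * y)"
    by (rule T_rotation1[where b = 1]; (simp only: golden_norm Ints_1 Ints_numeral)?;
      (linarith | (insert facts, simp only: golden_norm; linarith))?)
  have s2: "(T_map ^^ 1) (1 + (g - 1) * u - (2 - g) * y, 2 - g - (2 - g) * u - (2 - g) * y) =
      (2 - g - (2 - g) * u - (2 - g) * y, 4 - 2 * g - (2 - g) * u + (g - 1) * y)"
    by (rule T_rotation1[where b = 2]; (simp only: golden_norm Ints_1 Ints_numeral)?;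
      (linarith | (insert facts, simp only: golden_norm; linarith))?)
  show ?thesis using funpow_trans[OF s1 s2]
    by (simp only: wedge_point_def prod.case one_add_one golden_norm; simp add: golden_norm)
qed

lemma T_word_B:
  assumes "0 < u" "g * u < y" "u + y \<le> 1" "1 + g * u \<le> (g + 1) * y" "1 \<le> g * (u + y)"
    "g * y < 1 + (g + 1) * u"
  shows "(T_map ^^ 5) (wedge_point (u, y)) = wedge_point (2 - g - u, 2 * g - 2 - y)"
proof -
  note facts = assms(1) assms(1)[THEN golden_less(2)] assms(3)[THEN golden_le(3)]
    assms(2,6)[THEN golden_less(4)] assms(3,4)[THEN golden_le(4)] golden_bounds
  have s1: "(T_map ^^ 4) ((g - 1) * y, 1 + (g - 1) * u - (2 - g) * y) =
      (4 - 2 * g + (g - 1) * u, 4 - 2 * g - (g - 1) * y)"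
    by (rule T_rotation4[where b = 1]; (simp only: golden_norm Ints_1 Ints_numeral)?;
      (linarith | (insert facts, simp only: golden_norm; linarith))?)
  have s2: "(T_map ^^ 1) (4 - 2 * g + (g - 1) * u, 4 - 2 * g - (g - 1) * y) =
      (4 - 2 * g - (g - 1) * y, 4 - 2 * g - (g - 1) * u + (2 - g) * y)"
    by (rule T_rotation1[where b = 2]; (simp only: golden_norm Ints_1 Ints_numeral)?;
      (linarith | (insert facts, simp only: golden_norm; linarith))?)
  show ?thesis using funpow_trans[OF s1 s2]
    by (simp only: wedge_point_def prod.case one_add_one golden_norm; simp add: golden_norm)
qed

lemma T_word_C:
  assumes "0 < u" "g * u < y" "u + y \<le> 1" "1 + g * u \<le> (g + 1) * y" "g * (u + y) < 1"
  shows "(T_map ^^ 8) (wedge_point (u, y)) =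
      wedge_point (2 - g - (g - 1) * u - (g - 1) * y, 2 * g - 2 + (g - 1) * u - y)"
proof -
  note facts = assms(2,5) assms(1)[THEN golden_less(2)] assms(3)[THEN golden_le(2)]
    assms(1)[THEN golden_less(3)] assms(5)[THEN golden_less(4)] assms(4)[THEN golden_le(4)]
    golden_bounds
  have s1: "(T_map ^^ 4) ((g - 1) * y, 1 + (g - 1) * u - (2 - g) * y) =
      (4 - 2 * g + (g - 1) * u, 4 - 2 * g - (g - 1) * y)"
    by (rule T_rotation4[where b = 1]; (simp only: golden_norm Ints_1 Ints_numeral)?;
      (linarith | (insert facts, simp only: golden_norm; linarith))?)
  have s2: "(T_map ^^ 4) (4 - 2 * g + (g - 1) * u, 4 - 2 * g - (g - 1) * y) =
      (4 - 2 * g + (2 - g) * u - (g - 1) * y, 4 - 2 * g - (g - 1) * u)"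
    by (rule T_rotation4[where b = 2]; (simp only: golden_norm Ints_1 Ints_numeral)?;
      (linarith | (insert facts, simp only: golden_norm; linarith))?)
  show ?thesis using funpow_trans[OF s1 s2]
    by (simp only: wedge_point_def prod.case one_add_one golden_norm; simp add: golden_norm)
qed

lemma T_word_E:
  assumes "0 < u" "g * u < y" "u + y \<le> 1" "1 + (g + 1) * u \<le> g * y" "(g + 1) * y < 2 + g * u"
  shows "(T_map ^^ 14) (wedge_point (u, y)) =
      wedge_point (4 - 2 * g + (g - 1) * u - y, 3 * g - 4 + u)"
proof -
  note facts = assms(1) assms(4) assms(1)[THEN golden_less(2)] assms(3)[THEN golden_le(3)]
    assms(5)[THEN golden_less(4)] assms(4)[THEN golden_le(4)] golden_bounds
  have s1: "(T_map ^^ 7) ((g - 1) * y, 1 + (g - 1) * u - (2 - g) * y) =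
      (2 - g + (2 - g) * u + (2 - g) * y, 1 + (2 - g) * u - (g - 1) * y)"
    by (rule T_rotation7[where b = 1]; (simp only: golden_norm Ints_1 Ints_numeral)?;
      (linarith | (insert facts, simp only: golden_norm; linarith))?)
  have s2: "(T_map ^^ 7) (2 - g + (2 - g) * u + (2 - g) * y, 1 + (2 - g) * u - (g - 1) * y) =
      (7 - 4 * g + (g - 1) * u, 6 - 3 * g - (g - 1) * y)"
    by (rule T_rotation7[where b = 2]; (simp only: golden_norm Ints_1 Ints_numeral)?;
      (linarith | (insert facts, simp only: golden_norm; linarith))?)
  show ?thesis using funpow_trans[OF s1 s2]
    by (simp only: wedge_point_def prod.case one_add_one golden_norm; simp add: golden_norm)
qed

lemma T_word_D:
  assumes "0 < u" "g * u < y" "u + y \<le> 1" "2 + g * u \<le> (g + 1) * y"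
  shows "(T_map ^^ 11) (wedge_point (u, y)) = wedge_point (1 - y, 2 * g - 2 + u - (g - 1) * y)"
proof -
  note facts = assms(1)[THEN golden_less(2)] assms(1)[THEN golden_less(3)]
    assms(3)[THEN golden_le(3)] assms(3,4)[THEN golden_le(4)] golden_bounds
  have s1: "(T_map ^^ 7) ((g - 1) * y, 1 + (g - 1) * u - (2 - g) * y) =
      (2 - g + (2 - g) * u + (2 - g) * y, 1 + (2 - g) * u - (g - 1) * y)"
    by (rule T_rotation7[where b = 1]; (simp only: golden_norm Ints_1 Ints_numeral)?;
      (linarith | (insert facts, simp only: golden_norm; linarith))?)
  have s2: "(T_map ^^ 4) (2 - g + (2 - g) * u + (2 - g) * y, 1 + (2 - g) * u - (g - 1) * y) =
      (4 - 2 * g + (g - 1) * u - (2 - g) * y, 6 - 3 * g - (2 - g) * u - (2 - g) * y)"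
    by (rule T_rotation4[where b = 2]; (simp only: golden_norm Ints_1 Ints_numeral)?;
      (linarith | (insert facts, simp only: golden_norm; linarith))?)
  show ?thesis using funpow_trans[OF s1 s2]
    by (simp only: wedge_point_def prod.case one_add_one golden_norm; simp add: golden_norm)
qed

text \<open>A rotation by two fifths of a full turn. With \<open>c = g - 1\<close> it is the letter A, with \<open>c = 1\<close> it is the
rotation of the larger piece of \<open>tri_map\<close>.\<close>

definition skew :: "real \<Rightarrow> real \<times> real \<Rightarrow> real \<times> real" where
  "skew c = (\<lambda>(u, y). (- u + (g - 1) * y, c - (g - 1) * u - (g - 1) * y))"

lemma skew_order: "(skew c ^^ 5) z = z"
proof (cases z)
  case (Pair u y)
  let ?p1 = "(- u + (g - 1) * y, c - (g - 1) * u - (g - 1) * y)"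
  let ?p2 = "((g - 1) * (c + u) - y, (2 - g) * c + u)"
  let ?p3 = "(y - (2 - g) * c, (2 - g) * c - u + (g - 1) * y)"
  let ?p4 = "((g - 1) * (c - u - y), c + (g - 1) * u - y)"
  have "skew c (u, y) = ?p1" by (simp add: skew_def)
  moreover have "skew c ?p1 = ?p2" by (simp only: skew_def prod.case golden_norm) simp
  moreover have "skew c ?p2 = ?p3" by (simp only: skew_def prod.case golden_norm) simp
  moreover have "skew c ?p3 = ?p4" by (simp only: skew_def prod.case golden_norm) simp
  moreover have "skew c ?p4 = (u, y)" by (simp only: skew_def prod.case golden_norm) simp
  ultimately show ?thesis using Pair by (simp only: funpow_unroll)
qed

text \<open>The branches are the letters A, D, E, C and B, in this order.\<close>

definition wedge_return :: "real \<times> real \<Rightarrow> real \<times> real" where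
  "wedge_return = (\<lambda>(u, y).
     if (g + 1) * y < 1 + g * u then skew (g - 1) (u, y)
     else if 2 + g * u \<le> (g + 1) * y then (1 - y, 2 * g - 2 + u - (g - 1) * y)
     else if 1 + (g + 1) * u \<le> g * y then (4 - 2 * g + (g - 1) * u - y, 3 * g - 4 + u)
     else if g * (u + y) < 1 then (2 - g - (g - 1) * u - (g - 1) * y, 2 * g - 2 + (g - 1) * u - y)
     else (2 - g - u, 2 * g - 2 - y))"

lemma wedge_return_A:
  assumes "(g + 1) * y < 1 + g * u" "p = - u + (g - 1) * y" "q = g - 1 - (g - 1) * u - (g - 1) * y"
  shows "wedge_return (u, y) = (p, q)"
  by (simp only: wedge_return_def skew_def prod.case assms if_True)

lemma wedge_return_D:
  assumes "2 + g * u \<le> (g + 1) * y" "p = 1 - y" "q = 2 * g - 2 + u - (g - 1) * y"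
  shows "wedge_return (u, y) = (p, q)"
proof -
  have A: "\<not> (g + 1) * y < 1 + g * u" using assms(1) by linarith
  show ?thesis by (simp only: wedge_return_def prod.case assms A if_True if_False)
qed

lemma wedge_return_E:
  assumes "0 < u" "g * u < y" "1 + (g + 1) * u \<le> g * y" "(g + 1) * y < 2 + g * u"
    "p = 4 - 2 * g + (g - 1) * u - y" "q = 3 * g - 4 + u"
  shows "wedge_return (u, y) = (p, q)"
proof -
  have "0 < g * u" using assms(1) golden_bounds by simp
  then have "0 < y" using assms(2) by linarith
  then have A: "\<not> (g + 1) * y < 1 + g * u" using assms(1,3) by (simp only: golden_norm)
  have D: "\<not> 2 + g * u \<le> (g + 1) * y" using assms(4) by linarith
  show ?thesis by (simp only: wedge_return_def prod.case assms(3,5,6) A D if_True if_False)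
qed

lemma wedge_return_C:
  assumes "0 < u" "g * u < y" "1 + g * u \<le> (g + 1) * y" "g * (u + y) < 1"
    "p = 2 - g - (g - 1) * u - (g - 1) * y" "q = 2 * g - 2 + (g - 1) * u - y"
  shows "wedge_return (u, y) = (p, q)"
proof -
  have u: "0 < g * u" using assms(1) golden_bounds by simp
  then have y: "0 < y" using assms(2) by linarith
  have A: "\<not> (g + 1) * y < 1 + g * u" using assms(3) by linarith
  have E: "\<not> 1 + (g + 1) * u \<le> g * y" using assms(1,4) u by (simp only: golden_norm)
  have "0 < (g - 1) * y" using y golden_bounds by simp
  then have D: "\<not> 2 + g * u \<le> (g + 1) * y" using assms(4) u by (simp only: golden_norm)
  show ?thesis by (simp only: wedge_return_def prod.case assms(4-6) A D E if_True if_False)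
qed

lemma wedge_return_B:
  assumes "0 < u" "g * u < y" "u + y \<le> 1" "1 + g * u \<le> (g + 1) * y" "1 \<le> g * (u + y)"
    "g * y < 1 + (g + 1) * u"
    "p = 2 - g - u" "q = 2 * g - 2 - y"
  shows "wedge_return (u, y) = (p, q)"
proof -
  have A: "\<not> (g + 1) * y < 1 + g * u" using assms(4) by linarith
  have D: "\<not> 2 + g * u \<le> (g + 1) * y" using assms(3,6) by (simp only: golden_norm)
  have E: "\<not> 1 + (g + 1) * u \<le> g * y" using assms(6) by linarith
  have C: "\<not> g * (u + y) < 1" using assms(5) by linarith
  show ?thesis by (simp only: wedge_return_def prod.case assms(7,8) A C D E if_False)
qed

lemma wedge_return_A_stays:
  assumes "0 < u" "g * u < y" "u + y \<le> 1" "(g + 1) * y < 1 + g * u"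
  shows "0 < (- u + (g - 1) * y)" "g * (- u + (g - 1) * y) < (g - 1 - (g - 1) * u - (g - 1) * y)"
    "(- u + (g - 1) * y) + (g - 1 - (g - 1) * u - (g - 1) * y) \<le> 1"
  by ((simp only: golden_norm)?;
    (linarith | (insert assms(1)[THEN golden_less(1)] assms(2,4)[THEN golden_less(2)] golden_bounds,
      simp only: golden_norm; linarith)))+

lemma wedge_return_B_stays:
  assumes "0 < u" "g * u < y" "u + y \<le> 1" "1 + g * u \<le> (g + 1) * y" "1 \<le> g * (u + y)"
    "g * y < 1 + (g + 1) * u"
  shows "0 < (2 - g - u)" "g * (2 - g - u) < (2 * g - 2 - y)" "(2 - g - u) + (2 * g - 2 - y) \<le> 1"
  by ((simp only: golden_norm)?;
    (linarith | (insert assms(6)[THEN golden_less(2)] assms(5)[THEN golden_le(2)]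
      assms(2)[THEN golden_less(3)] assms(3)[THEN golden_le(3)] golden_bounds,
      simp only: golden_norm; linarith)))+

lemma wedge_return_C_stays:
  assumes "0 < u" "g * u < y" "u + y \<le> 1" "1 + g * u \<le> (g + 1) * y" "g * (u + y) < 1"
  shows "0 < (2 - g - (g - 1) * u - (g - 1) * y)"
    "g * (2 - g - (g - 1) * u - (g - 1) * y) < (2 * g - 2 + (g - 1) * u - y)"
    "(2 - g - (g - 1) * u - (g - 1) * y) + (2 * g - 2 + (g - 1) * u - y) \<le> 1"
  by ((simp only: golden_norm)?;
    (linarith | (insert assms(1) assms(1)[THEN golden_less(1)] assms(4)[THEN golden_le(2)]
      assms(5)[THEN golden_less(3)] golden_bounds,
      simp only: golden_norm; linarith)))+

lemma wedge_return_E_stays: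
  assumes "0 < u" "g * u < y" "u + y \<le> 1" "1 + (g + 1) * u \<le> g * y" "(g + 1) * y < 2 + g * u"
  shows "0 < (4 - 2 * g + (g - 1) * u - y)" "g * (4 - 2 * g + (g - 1) * u - y) < (3 * g - 4 + u)"
    "(4 - 2 * g + (g - 1) * u - y) + (3 * g - 4 + u) \<le> 1"
  by ((simp only: golden_norm)?;
    (linarith | (insert assms(1) assms(4) assms(1)[THEN golden_less(1)] assms(4)[THEN golden_le(2)]
      assms(5)[THEN golden_less(3)] golden_bounds,
      simp only: golden_norm; linarith)))+

lemma wedge_return_D_stays:
  assumes "0 < u" "g * u < y" "u + y \<le> 1" "2 + g * u \<le> (g + 1) * y"
  shows "0 < (1 - y)" "g * (1 - y) < (2 * g - 2 + u - (g - 1) * y)"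
    "(1 - y) + (2 * g - 2 + u - (g - 1) * y) \<le> 1"
  by ((simp only: golden_norm)?;
    (linarith | (insert assms(1) assms(3,4) assms(1)[THEN golden_less(1)]
      assms(3)[THEN golden_le(1)] assms(4)[THEN golden_le(2)] golden_bounds,
      simp only: golden_norm; linarith)))+

lemma wedge_return_correct: "speeds_up wedge_return wedge T_map wedge_point"
proof -
  have "wedge_return (u, y) \<in> wedge \<and>
      (\<exists>n\<ge>1. (T_map ^^ n) (wedge_point (u, y)) = wedge_point (wedge_return (u, y)))"
    if "(u, y) \<in> wedge" for u y
  proof -
    have w: "0 < u" "g * u < y" "u + y \<le> 1" using that by (auto simp: wedge_def)
    consider (A) "(g + 1) * y < 1 + g * u" | (D) "2 + g * u \<le> (g + 1) * y"
      | (E) "1 + (g + 1) * u \<le> g * y" "(g + 1) * y < 2 + g * u"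
      | (C) "1 + g * u \<le> (g + 1) * y" "g * (u + y) < 1"
      | (B) "1 + g * u \<le> (g + 1) * y" "1 \<le> g * (u + y)" "g * y < 1 + (g + 1) * u"
      by linarith
    then show ?thesis
    proof cases
      case A
      note r = wedge_return_A[OF A refl refl]
      have "wedge_return (u, y) \<in> wedge" unfolding r wedge_def
        using wedge_return_A_stays[OF w A] by blast
      moreover have "(T_map ^^ 2) (wedge_point (u, y)) = wedge_point (wedge_return (u, y))"
        unfolding r by (rule T_word_A[OF w A])
      ultimately show ?thesis by (metis one_le_numeral)
    next
      case B
      note r = wedge_return_B[OF w B refl refl]
      have "wedge_return (u, y) \<in> wedge" unfolding r wedge_def
        using wedge_return_B_stays[OF w B] by blast
      moreover have "(T_map ^^ 5) (wedge_point (u, y)) = wedge_point (wedge_return (u, y))"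
        unfolding r by (rule T_word_B[OF w B])
      ultimately show ?thesis by (metis one_le_numeral)
    next
      case C
      note r = wedge_return_C[OF w(1,2) C refl refl]
      have "wedge_return (u, y) \<in> wedge" unfolding r wedge_def
        using wedge_return_C_stays[OF w C] by blast
      moreover have "(T_map ^^ 8) (wedge_point (u, y)) = wedge_point (wedge_return (u, y))"
        unfolding r by (rule T_word_C[OF w C])
      ultimately show ?thesis by (metis one_le_numeral)
    next
      case D
      note r = wedge_return_D[OF D refl refl]
      have "wedge_return (u, y) \<in> wedge" unfolding r wedge_def
        using wedge_return_D_stays[OF w D] by blast
      moreover have "(T_map ^^ 11) (wedge_point (u, y)) = wedge_point (wedge_return (u, y))"
        unfolding r by (rule T_word_D[OF w D])
      ultimately show ?thesis by (metis one_le_numeral)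
    next
      case E
      note r = wedge_return_E[OF w(1,2) E refl refl]
      have "wedge_return (u, y) \<in> wedge" unfolding r wedge_def
        using wedge_return_E_stays[OF w E] by blast
      moreover have "(T_map ^^ 14) (wedge_point (u, y)) = wedge_point (wedge_return (u, y))"
        unfolding r by (rule T_word_E[OF w E])
      ultimately show ?thesis by (metis one_le_numeral)
    qed
  qed
  then show ?thesis unfolding speeds_up_def Ball_def split_paired_All by blast
qed

text \<open>Which letters can follow each other. Together with the finite order of A, B and the product of D
and E these transitions show that an orbit is periodic or passes through the tip of the wedge.\<close>

lemma A_exits_from_tip:
  assumes "0 < u" "g * u < y" "u + y \<le> 1" "(g + 1) * y < 1 + g * u"
    "1 + g * (- u + (g - 1) * y) \<le> (g + 1) * (g - 1 - (g - 1) * u - (g - 1) * y)"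
  shows "(2 * g + 1) * y \<le> 1"
  by ((simp only: golden_norm)?;
    (linarith | (insert assms(5)[THEN golden_le(1)] golden_bounds,
      simp only: golden_norm; linarith)))

lemma B_then_A_or_B:
  assumes "0 < u" "g * u < y" "u + y \<le> 1" "1 + g * u \<le> (g + 1) * y" "1 \<le> g * (u + y)"
    "g * y < 1 + (g + 1) * u"
  shows "g * (2 * g - 2 - y) < 1 + (g + 1) * (2 - g - u)"
    "(g + 1) * (2 * g - 2 - y) < 2 + g * (2 - g - u)"
  by ((simp only: golden_norm)?;
    (linarith | (insert assms(4) assms(2)[THEN golden_less(1)] golden_bounds,
      simp only: golden_norm; linarith)))+

lemma B_then_not_C:
  assumes "0 < u" "g * u < y" "u + y \<le> 1" "1 + g * u \<le> (g + 1) * y" "1 \<le> g * (u + y)"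
    "g * y < 1 + (g + 1) * u" "1 + g * (2 - g - u) \<le> (g + 1) * (2 * g - 2 - y)"
  shows "1 \<le> g * ((2 - g - u) + (2 * g - 2 - y))"
  by ((simp only: golden_norm)?;
    (linarith | (insert assms(3)[THEN golden_le(1)] golden_bounds,
      simp only: golden_norm; linarith)))

lemma C_then_D_or_E:
  assumes "0 < u" "g * u < y" "u + y \<le> 1" "1 + g * u \<le> (g + 1) * y" "g * (u + y) < 1"
  shows "1 + (g + 1) * (2 - g - (g - 1) * u - (g - 1) * y) \<le> g * (2 * g - 2 + (g - 1) * u - y)"
  by ((simp only: golden_norm)?;
    (linarith | (insert assms(1) assms(1)[THEN golden_less(1)] golden_bounds,
      simp only: golden_norm; linarith)))

lemma E_then_D:
  assumes "0 < u" "g * u < y" "u + y \<le> 1" "1 + (g + 1) * u \<le> g * y" "(g + 1) * y < 2 + g * u"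
  shows "2 + g * (4 - 2 * g + (g - 1) * u - y) \<le> (g + 1) * (3 * g - 4 + u)"
  by ((simp only: golden_norm)?;
    (linarith | (insert assms(1) assms(4) assms(1)[THEN golden_less(1)] golden_bounds,
      simp only: golden_norm; linarith)))

lemma D_then_not_A_C:
  assumes "0 < u" "g * u < y" "u + y \<le> 1" "2 + g * u \<le> (g + 1) * y"
  shows "1 + g * (1 - y) \<le> (g + 1) * (2 * g - 2 + u - (g - 1) * y)"
    "1 \<le> g * ((1 - y) + (2 * g - 2 + u - (g - 1) * y))"
  by ((simp only: golden_norm)?;
    (linarith | (insert assms(1) assms(3) assms(1)[THEN golden_less(1)] assms(3)[THEN golden_le(1)]
      golden_bounds,
      simp only: golden_norm; linarith)))+

text \<open>The letter D can only be repeated at a single boundary vertex, which is a fixed point. Under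
the original map this vertex has period eleven, the length of D.\<close>

lemma D_D_fixed:
  assumes "0 < u" "g * u < y" "u + y \<le> 1" "2 + g * u \<le> (g + 1) * y"
    "2 + g * (1 - y) \<le> (g + 1) * (2 * g - 2 + u - (g - 1) * y)"
  shows "u = 5 - 3 * g" "y = 3 * g - 4"
  by ((simp only: golden_norm)?;
    (linarith | (insert assms(3,5) assms(3,4,5)[THEN golden_le(1)] golden_bounds,
      simp only: golden_norm; linarith)))+

text \<open>The part of the cone with \<open>y\<close> at most \<open>g^-3\<close>, since \<open>2 * g + 1 = g^3\<close>.\<close>

definition tip :: "(real \<times> real) set" where
  "tip = {(u, y). 0 < u \<and> g * u < y \<and> (2 * g + 1) * y \<le> 1}"

definition settles :: "real \<times> real \<Rightarrow> bool" where
  "settles p \<longleftrightarrow> eventually_periodic wedge_return p \<or> (\<exists>n. (wedge_return ^^ n) p \<in> tip)"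

lemma settles_before:
  assumes "settles ((wedge_return ^^ n) p)"
  shows "settles p"
proof -
  have "(wedge_return ^^ m) ((wedge_return ^^ n) p) = (wedge_return ^^ (n + m)) p" for m
    by (rule funpow_trans[OF refl refl, symmetric])
  then show ?thesis
    using assms eventually_periodic_before[of wedge_return n p] unfolding settles_def by metis
qed

lemma settles_step: "settles (wedge_return p) \<Longrightarrow> settles p"
  using settles_before[of 1 p] by simp

text \<open>The letter A is a rotation of order five and can only be left through the tip. B is a point reflection,
followed by B, which closes the orbit, or by A. D and E alternate, and \<open>D E\<close> is again a point
reflection, unless D is followed by B or is at its fixed vertex. C leads to D or E.\<close>

lemma wedge_settles:
  assumes p: "p \<in> wedge"
  shows "settles p"
proof -
  have stays: "wedge_return q \<in> wedge" if "q \<in> wedge" for q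
    using wedge_return_correct that unfolding speeds_up_def by blast
  let ?A = "{(u, y). (u, y) \<in> wedge \<and> (g + 1) * y < 1 + g * u}"
  have settles_A: "settles q" if "q \<in> ?A" for q
  proof -
    have ret: "wedge_return w = skew (g - 1) w" if "w \<in> ?A" for w
      using that by (auto simp: wedge_return_def)
    have "eventually_periodic wedge_return q \<or>
        (\<exists>k. (wedge_return ^^ k) q = (skew (g - 1) ^^ k) q \<and>
          (wedge_return ^^ k) q \<in> ?A \<and> (wedge_return ^^ Suc k) q \<notin> ?A)"
      by (rule cycle_or_exit[OF _ skew_order _ that]) (erule ret, simp)
    then show ?thesis
    proof (elim disjE exE conjE)
      fix k assume k: "(wedge_return ^^ k) q \<in> ?A" "(wedge_return ^^ Suc k) q \<notin> ?A"
      obtain u y where uy: "(wedge_return ^^ k) q = (u, y)" by fastforce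
      have h: "0 < u" "g * u < y" "u + y \<le> 1" "(g + 1) * y < 1 + g * u" "(u, y) \<in> wedge"
        using k(1) unfolding uy by (auto simp: wedge_def)
      have "wedge_return (u, y) \<notin> ?A" using k(2) uy by simp
      moreover have r: "wedge_return (u, y) =
          (- u + (g - 1) * y, g - 1 - (g - 1) * u - (g - 1) * y)"
        by (rule wedge_return_A[OF h(4) refl refl])
      ultimately have "\<not> (g + 1) * (g - 1 - (g - 1) * u - (g - 1) * y) < 1 + g * (- u +
        (g - 1) * y)"
        using stays[OF h(5)] by simp
      then have "(2 * g + 1) * y \<le> 1" using A_exits_from_tip[OF h(1-4)] by simp
      then have "(u, y) \<in> tip" using h(1,2) unfolding tip_def by simp
      then show ?thesis unfolding settles_def using uy by metis
    qed (simp add: settles_def)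
  qed
  have settles_B: "settles (u, y)" if w: "(u, y) \<in> wedge"
    and h: "1 + g * u \<le> (g + 1) * y" "1 \<le> g * (u + y)" "g * y < 1 + (g + 1) * u" for u y
  proof -
    have w': "0 < u" "g * u < y" "u + y \<le> 1" using w by (auto simp: wedge_def)
    let ?v = "2 - g - u" and ?z = "2 * g - 2 - y"
    have r: "wedge_return (u, y) = (?v, ?z)"
      by (rule wedge_return_B) (use w' h in simp_all)
    have img: "(?v, ?z) \<in> wedge" using stays[OF w] r by simp
    then have i: "0 < ?v" "g * ?v < ?z" "?v + ?z \<le> 1" by (auto simp: wedge_def)
    show ?thesis
    proof (cases "(g + 1) * ?z < 1 + g * ?v")
      case True
      have "settles (?v, ?z)" by (rule settles_A) (use True img in simp)
      then show ?thesis using settles_step[of "(u, y)"] r by simp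
    next
      case False
      then have "1 + g * ?v \<le> (g + 1) * ?z" by simp
      then have "wedge_return (?v, ?z) = (u, y)"
        using B_then_A_or_B[OF w' h] B_then_not_C[OF w' h] i by (intro wedge_return_B) simp_all
      then have "(wedge_return ^^ 2) (u, y) = (u, y)" using r by (simp add: funpow_unroll)
      then show ?thesis using eventually_periodicI[of 2] unfolding settles_def by force
    qed
  qed
  let ?D = "{(u, y). (u, y) \<in> wedge \<and> 2 + g * u \<le> (g + 1) * y}"
  let ?E = "{(u, y). (u, y) \<in> wedge \<and> 1 + (g + 1) * u \<le> g * y \<and> (g + 1) * y < 2 + g * u}"
  \<comment> \<open>The rotations of the letters D and E.\<close>
  define d where "d = (\<lambda>(u :: real, y). (1 - y, 2 * g - 2 + u - (g - 1) * y))"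
  define e where "e = (\<lambda>(u, y). (4 - 2 * g + (g - 1) * u - y, 3 * g - 4 + u))"
  have ret_d: "wedge_return q = d q" if "q \<in> ?D" for q
    using that by (cases q) (auto simp: d_def intro!: wedge_return_D)
  have ret_e: "wedge_return q = e q" if "q \<in> ?E" for q
    using that by (cases q) (auto simp: e_def wedge_def intro!: wedge_return_E)
  have D_to_E: "settles q \<or> wedge_return q \<in> ?E" if q: "q \<in> ?D" for q
  proof -
    obtain u y where uy: "q = (u, y)" by (cases q)
    have w: "(u, y) \<in> wedge" and h: "0 < u" "g * u < y" "u + y \<le> 1" "2 + g * u \<le> (g + 1) * y"
      using q uy by (auto simp: wedge_def)
    let ?v = "1 - y" and ?z = "2 * g - 2 + u - (g - 1) * y"
    have r: "wedge_return (u, y) = (?v, ?z)" using ret_d[OF q] uy by (simp add: d_def)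
    then have img: "(?v, ?z) \<in> wedge" using stays[OF w] by simp
    note n = D_then_not_A_C[OF h]
    show ?thesis
    proof (cases "2 + g * ?v \<le> (g + 1) * ?z")
      case True
      then have "u = 5 - 3 * g" "y = 3 * g - 4" using D_D_fixed[OF h] by simp_all
      then have "wedge_return q = q" using r uy by (simp add: golden_norm)
      then show ?thesis using eventually_periodicI[of 1 wedge_return q] unfolding settles_def
        by simp
    next
      case False
      show ?thesis
      proof (cases "g * ?z < 1 + (g + 1) * ?v")
        case True
        then have "settles (?v, ?z)" using settles_B[OF img] n by simp
        then show ?thesis using settles_step[of q] r uy by simp
      next
        case False': False
        then show ?thesis using False r uy img by simp
      qed
    qed
  qed
  have E_to_D: "wedge_return q \<in> ?D" if q: "q \<in> ?E" for q
  proof -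
    obtain u y where uy: "q = (u, y)" by (cases q)
    have w: "(u, y) \<in> wedge" and h: "0 < u" "g * u < y" "u + y \<le> 1"
      "1 + (g + 1) * u \<le> g * y" "(g + 1) * y < 2 + g * u"
      using q uy by (auto simp: wedge_def)
    have r: "wedge_return q = (4 - 2 * g + (g - 1) * u - y, 3 * g - 4 + u)"
      using ret_e[OF q] uy by (simp add: e_def)
    then show ?thesis using stays[OF w] E_then_D[OF h] uy by simp
  qed
  have settles_D: "settles q" if q: "q \<in> ?D" for q
  proof (rule ccontr)
    assume no: "\<not> settles q"
    then have 1: "wedge_return q \<in> ?E" using D_to_E[OF q] by metis
    then have 2: "wedge_return (wedge_return q) \<in> ?D" by (rule E_to_D)
    have "\<not> settles (wedge_return (wedge_return q))" using no settles_step by blast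
    then have 3: "wedge_return (wedge_return (wedge_return q)) \<in> ?E" using D_to_E[OF 2] by metis
    obtain u y where uy: "q = (u, y)" by (cases q)
    have "(wedge_return ^^ 4) q = e (d (e (d q)))"
      using ret_d[OF q] ret_e[OF 1] ret_d[OF 2] ret_e[OF 3] by (simp only: funpow_unroll)
    also have "e (d q) = (5 - 3 * g - u, 3 * g - 3 - y)" unfolding e_def d_def uy prod.case
      by (simp add: golden_norm)
    finally have "(wedge_return ^^ 4) q = q"
      unfolding e_def d_def uy prod.case by (simp add: golden_norm)
    then show False using no eventually_periodicI[of 4 wedge_return q] unfolding settles_def by simp
  qed
  have settles_E: "settles q" if "q \<in> ?E" for q
    using settles_step[OF settles_D[OF E_to_D[OF that]]] .
  obtain u y where uy: "p = (u, y)" by (cases p)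
  have w: "0 < u" "g * u < y" "u + y \<le> 1" using p uy by (auto simp: wedge_def)
  consider (A) "(g + 1) * y < 1 + g * u" | (D) "2 + g * u \<le> (g + 1) * y"
    | (E) "1 + (g + 1) * u \<le> g * y" "(g + 1) * y < 2 + g * u"
    | (C) "1 + g * u \<le> (g + 1) * y" "g * (u + y) < 1"
    | (B) "1 + g * u \<le> (g + 1) * y" "1 \<le> g * (u + y)" "g * y < 1 + (g + 1) * u"
    by linarith
  then show ?thesis
  proof cases
    case C
    let ?v = "2 - g - (g - 1) * u - (g - 1) * y" and ?z = "2 * g - 2 + (g - 1) * u - y"
    have r: "wedge_return (u, y) = (?v, ?z)"
      by (rule wedge_return_C) (use w C in simp_all)
    have img: "(?v, ?z) \<in> wedge" using stays[OF p] r uy by simp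
    have "settles (?v, ?z)"
    proof (cases "2 + g * ?v \<le> (g + 1) * ?z")
      case True
      then show ?thesis using img by (intro settles_D) simp
    next
      case False
      then show ?thesis using img C_then_D_or_E[OF w C] by (intro settles_E) simp
    qed
    then show ?thesis using settles_step[of p] r uy by simp
  next
    case A
    then show ?thesis using settles_A[of p] p uy by simp
  next
    case B
    then show ?thesis using settles_B[of u y] p uy by simp
  next
    case D
    then show ?thesis using settles_D[of p] p uy by simp
  next
    case E
    then show ?thesis using settles_E[of p] p uy by simp
  qed
qed

section \<open>The self-similar triangle exchange\<close>

text \<open>The tip, enlarged by \<open>g^3\<close>. The side \<open>y = 1\<close> belongs to the set and the other two sides do not; with
this choice the two pieces of \<open>tri_map\<close> follow one itinerary each, boundary included.\<close>

definition tri :: "(real \<times> real) set" where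
  "tri = {(u, y). 0 < u \<and> g * u < y \<and> y \<le> 1}"

text \<open>The rotation by two fifths of a full turn in the direction opposite to \<open>skew\<close>.\<close>

definition flip :: "real \<times> real \<Rightarrow> real \<times> real" where
  "flip = (\<lambda>(u, y). (1 - (g - 1) * u - (g - 1) * y, g + (g - 1) * u - y))"

definition tri_map :: "real \<times> real \<Rightarrow> real \<times> real" where
  "tri_map = (\<lambda>(u, y). if g * y < 1 + u then skew 1 (u, y) else flip (u, y))"

lemma flip_order: "(flip ^^ 5) z = z"
proof (cases z)
  case (Pair u y)
  let ?p1 = "(1 - (g - 1) * u - (g - 1) * y, g + (g - 1) * u - y)"
  let ?p2 = "(1 - g + y, g - 1 - u + (g - 1) * y)"
  let ?p3 = "(1 + (g - 1) * u - y, g - 1 + u)"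
  let ?p4 = "(- u + (g - 1) * y, g - (g - 1) * u - (g - 1) * y)"
  have "flip (u, y) = ?p1" by (simp add: flip_def)
  moreover have "flip ?p1 = ?p2" by (simp only: flip_def prod.case golden_norm) simp
  moreover have "flip ?p2 = ?p3" by (simp only: flip_def prod.case golden_norm) simp
  moreover have "flip ?p3 = ?p4" by (simp only: flip_def prod.case golden_norm) simp
  moreover have "flip ?p4 = (u, y)" by (simp only: flip_def prod.case golden_norm) simp
  ultimately show ?thesis using Pair by (simp only: funpow_unroll)
qed

lemma tri_map_skew:
  assumes "g * y < 1 + u" "p = - u + (g - 1) * y" "q = 1 - (g - 1) * u - (g - 1) * y"
  shows "tri_map (u, y) = (p, q)"
  by (simp only: tri_map_def skew_def prod.case assms if_True)

lemma tri_map_flip: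
  assumes "1 + u \<le> g * y" "p = 1 - (g - 1) * u - (g - 1) * y" "q = g + (g - 1) * u - y"
  shows "tri_map (u, y) = (p, q)"
proof -
  have "\<not> g * y < 1 + u" using assms(1) by linarith
  then show ?thesis by (simp only: tri_map_def flip_def prod.case assms(2,3) if_False)
qed

lemma skew_stays_in_tri:
  assumes "0 < u" "g * u < y" "y \<le> 1" "g * y < 1 + u"
  shows "0 < (- u + (g - 1) * y)" "g * (- u + (g - 1) * y) < (1 - (g - 1) * u - (g - 1) * y)"
    "(1 - (g - 1) * u - (g - 1) * y) \<le> 1"
  by ((simp only: golden_norm)?;
    (linarith | (insert assms(4) assms(1)[THEN golden_less(1)] assms(2)[THEN golden_less(2)]
      golden_bounds,
      simp only: golden_norm; linarith)))+

lemma flip_stays_in_tri: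
  assumes "0 < u" "g * u < y" "y \<le> 1" "1 + u \<le> g * y"
  shows "0 < (1 - (g - 1) * u - (g - 1) * y)"
    "g * (1 - (g - 1) * u - (g - 1) * y) < (g + (g - 1) * u - y)" "(g + (g - 1) * u - y) \<le> 1"
  by ((simp only: golden_norm)?;
    (linarith | (insert assms(3) assms(1)[THEN golden_less(1)] assms(4)[THEN golden_le(2)]
      assms(2)[THEN golden_less(3)] golden_bounds,
      simp only: golden_norm; linarith)))+

text \<open>These two facts say that a change of piece only happens next to the shrunken triangle: an orbit that
goes from the first piece to the second was already in it before the change, and one that goes from
the second piece to the first enters it one step after the change, at a point with second
coordinate \<open>1 - g + y\<close>.\<close>

lemma skew_then_flip_low:
  assumes "0 < u" "g * u < y" "y \<le> 1" "g * y < 1 + u"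
    "1 + (- u + (g - 1) * y) \<le> g * (1 - (g - 1) * u - (g - 1) * y)"
  shows "(g + 1) * y \<le> 1"
  by ((simp only: golden_norm)?;
    (linarith | (insert assms(5)[THEN golden_le(1)] golden_bounds,
      simp only: golden_norm; linarith)))

lemma flip_then_skew_low:
  assumes "0 < u" "g * u < y" "y \<le> 1" "1 + u \<le> g * y"
    "g * (g + (g - 1) * u - y) < 1 + (1 - (g - 1) * u - (g - 1) * y)"
  shows "(g + 1) * (1 - g + y) \<le> 1"
  by ((simp only: golden_norm)?;
    (linarith | (insert assms(3) assms(3)[THEN golden_le(1)] golden_bounds,
      simp only: golden_norm; linarith)))

text \<open>The first piece of the tip returns to the tip after the letters A C E D B A, the second one after
A C D B A. In terms of the original map these are 42 and 28 steps.\<close>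

lemma tip_word_skew:
  assumes "0 < u" "g * u < y" "y \<le> 1" "g * y < 1 + u"
  shows "(wedge_return ^^ 6) ((2 * g - 3) * u, (2 * g - 3) * y) =
      (- (2 * g - 3) * u + (5 - 3 * g) * y, 2 * g - 3 - (5 - 3 * g) * u - (5 - 3 * g) * y)"
proof -
  note facts = assms(1,4) assms(3)[THEN golden_le(2)] assms(1,2)[THEN golden_less(4)]
    assms(2,4)[THEN golden_less(5)] golden_bounds
  have s1: "wedge_return ((2 * g - 3) * u, (2 * g - 3) * y) =
      (- (2 * g - 3) * u + (5 - 3 * g) * y, g - 1 - (5 - 3 * g) * u - (5 - 3 * g) * y)"
    by (rule wedge_return_A; (simp only: golden_norm)?;
      (linarith | (insert facts, simp only: golden_norm; linarith)))
  have s2: "wedge_return (- (2 * g - 3) * u + (5 - 3 * g) * y,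
    g - 1 - (5 - 3 * g) * u - (5 - 3 * g) * y) =
      ((2 * g - 3) * u, g - 1 + (2 * g - 3) * y)"
    by (rule wedge_return_C; (simp only: golden_norm)?;
      (linarith | (insert facts, simp only: golden_norm; linarith)))
  have s3: "wedge_return ((2 * g - 3) * u, g - 1 + (2 * g - 3) * y) =
      (5 - 3 * g + (5 - 3 * g) * u - (2 * g - 3) * y, 3 * g - 4 + (2 * g - 3) * u)"
    by (rule wedge_return_E; (simp only: golden_norm)?;
      (linarith | (insert facts, simp only: golden_norm; linarith)))
  have s4: "wedge_return (5 - 3 * g + (5 - 3 * g) * u - (2 * g - 3) * y,
    3 * g - 4 + (2 * g - 3) * u) =
      (5 - 3 * g - (2 * g - 3) * u, 3 * g - 4 - (2 * g - 3) * y)"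
    by (rule wedge_return_D; (simp only: golden_norm)?;
      (linarith | (insert facts, simp only: golden_norm; linarith)))
  have s5: "wedge_return (5 - 3 * g - (2 * g - 3) * u, 3 * g - 4 - (2 * g - 3) * y) =
      (2 * g - 3 + (2 * g - 3) * u, 2 - g + (2 * g - 3) * y)"
    by (rule wedge_return_B; (simp only: golden_norm)?;
      (linarith | (insert facts, simp only: golden_norm; linarith)))
  have s6: "wedge_return (2 * g - 3 + (2 * g - 3) * u, 2 - g + (2 * g - 3) * y) =
      (- (2 * g - 3) * u + (5 - 3 * g) * y, 2 * g - 3 - (5 - 3 * g) * u - (5 - 3 * g) * y)"
    by (rule wedge_return_A; (simp only: golden_norm)?;
      (linarith | (insert facts, simp only: golden_norm; linarith)))
  show ?thesis
    by (simp only: funpow_unroll s1 s2 s3 s4 s5 s6)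
qed

lemma tip_word_flip:
  assumes "0 < u" "g * u < y" "y \<le> 1" "1 + u \<le> g * y"
  shows "(wedge_return ^^ 5) ((2 * g - 3) * u, (2 * g - 3) * y) =
      (2 * g - 3 - (5 - 3 * g) * u - (5 - 3 * g) * y, 2 - g + (5 - 3 * g) * u - (2 * g - 3) * y)"
proof -
  note facts = assms(3) assms(3)[THEN golden_le(2)] assms(1)[THEN golden_less(3)]
    assms(4)[THEN golden_le(3)] assms(1,2)[THEN golden_less(4)] assms(4)[THEN golden_le(4)]
    assms(2)[THEN golden_less(5)] golden_bounds
  have s1: "wedge_return ((2 * g - 3) * u, (2 * g - 3) * y) =
      (- (2 * g - 3) * u + (5 - 3 * g) * y, g - 1 - (5 - 3 * g) * u - (5 - 3 * g) * y)"
    by (rule wedge_return_A; (simp only: golden_norm)?;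
      (linarith | (insert facts, simp only: golden_norm; linarith)))
  have s2: "wedge_return (- (2 * g - 3) * u + (5 - 3 * g) * y,
    g - 1 - (5 - 3 * g) * u - (5 - 3 * g) * y) =
      ((2 * g - 3) * u, g - 1 + (2 * g - 3) * y)"
    by (rule wedge_return_C; (simp only: golden_norm)?;
      (linarith | (insert facts, simp only: golden_norm; linarith)))
  have s3: "wedge_return ((2 * g - 3) * u, g - 1 + (2 * g - 3) * y) =
      (2 - g - (2 * g - 3) * y, 3 * g - 4 + (2 * g - 3) * u - (5 - 3 * g) * y)"
    by (rule wedge_return_D; (simp only: golden_norm)?;
      (linarith | (insert facts, simp only: golden_norm; linarith)))
  have s4: "wedge_return (2 - g - (2 * g - 3) * y, 3 * g - 4 + (2 * g - 3) * u - (5 - 3 * g) * y) =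
      ((2 * g - 3) * y, 2 - g - (2 * g - 3) * u + (5 - 3 * g) * y)"
    by (rule wedge_return_B; (simp only: golden_norm)?;
      (linarith | (insert facts, simp only: golden_norm; linarith)))
  have s5: "wedge_return ((2 * g - 3) * y, 2 - g - (2 * g - 3) * u + (5 - 3 * g) * y) =
      (2 * g - 3 - (5 - 3 * g) * u - (5 - 3 * g) * y, 2 - g + (5 - 3 * g) * u - (2 * g - 3) * y)"
    by (rule wedge_return_A; (simp only: golden_norm)?;
      (linarith | (insert facts, simp only: golden_norm; linarith)))
  show ?thesis
    by (simp only: funpow_unroll s1 s2 s3 s4 s5)
qed

text \<open>Writing \<open>a\<close> for \<open>skew\<close> and \<open>b\<close> for \<open>flip\<close>, the shrunken triangle returns to itself by the substitution
\<open>a \<mapsto> a b a\<close>, \<open>b \<mapsto> a b b b a\<close>.\<close>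

lemma shrink_word_skew:
  assumes "0 < u" "g * u < y" "y \<le> 1" "g * y < 1 + u"
  shows "(tri_map ^^ 3) ((2 - g) * u, (2 - g) * y) =
      (- (2 - g) * u + (2 * g - 3) * y, 2 - g - (2 * g - 3) * u - (2 * g - 3) * y)"
proof -
  note facts = assms(1)[THEN golden_less(2)] assms(3)[THEN golden_le(2)]
    assms(1,2,4)[THEN golden_less(3)] assms(2)[THEN golden_less(4)] golden_bounds
  have s1: "tri_map ((2 - g) * u, (2 - g) * y) =
      (- (2 - g) * u + (2 * g - 3) * y, 1 - (2 * g - 3) * u - (2 * g - 3) * y)"
    by (rule tri_map_skew; (simp only: golden_norm)?;
      (linarith | (insert facts, simp only: golden_norm; linarith)))
  have s2: "tri_map (- (2 - g) * u + (2 * g - 3) * y, 1 - (2 * g - 3) * u - (2 * g - 3) * y) =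
      (2 - g + (2 - g) * u, g - 1 + (2 - g) * y)"
    by (rule tri_map_flip; (simp only: golden_norm)?;
      (linarith | (insert facts, simp only: golden_norm; linarith)))
  have s3: "tri_map (2 - g + (2 - g) * u, g - 1 + (2 - g) * y) =
      (- (2 - g) * u + (2 * g - 3) * y, 2 - g - (2 * g - 3) * u - (2 * g - 3) * y)"
    by (rule tri_map_skew; (simp only: golden_norm)?;
      (linarith | (insert facts, simp only: golden_norm; linarith)))
  show ?thesis
    by (simp only: funpow_unroll s1 s2 s3)
qed

lemma shrink_word_flip:
  assumes "0 < u" "g * u < y" "y \<le> 1" "1 + u \<le> g * y"
  shows "(tri_map ^^ 5) ((2 - g) * u, (2 - g) * y) =
      (2 - g - (2 * g - 3) * u - (2 * g - 3) * y, g - 1 + (2 * g - 3) * u - (2 - g) * y)"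
proof -
  note facts = assms(1)[THEN golden_less(2)] assms(3)[THEN golden_le(2)]
    assms(1)[THEN golden_less(3)] assms(3,4)[THEN golden_le(3)] assms(2)[THEN golden_less(4)]
    assms(4)[THEN golden_le(4)] assms(2)[THEN golden_less(5)] golden_bounds
  have s1: "tri_map ((2 - g) * u, (2 - g) * y) =
      (- (2 - g) * u + (2 * g - 3) * y, 1 - (2 * g - 3) * u - (2 * g - 3) * y)"
    by (rule tri_map_skew; (simp only: golden_norm)?;
      (linarith | (insert facts, simp only: golden_norm; linarith)))
  have s2: "tri_map (- (2 - g) * u + (2 * g - 3) * y, 1 - (2 * g - 3) * u - (2 * g - 3) * y) =
      (2 - g + (2 - g) * u, g - 1 + (2 - g) * y)"
    by (rule tri_map_flip; (simp only: golden_norm)?;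
      (linarith | (insert facts, simp only: golden_norm; linarith)))
  have s3: "tri_map (2 - g + (2 - g) * u, g - 1 + (2 - g) * y) =
      (2 - g - (2 * g - 3) * u - (2 * g - 3) * y, 2 * g - 2 + (2 * g - 3) * u - (2 - g) * y)"
    by (rule tri_map_flip; (simp only: golden_norm)?;
      (linarith | (insert facts, simp only: golden_norm; linarith)))
  have s4: "tri_map (2 - g - (2 * g - 3) * u - (2 * g - 3) * y,
    2 * g - 2 + (2 * g - 3) * u - (2 - g) * y) =
      ((2 - g) * y, g - 1 - (2 - g) * u + (2 * g - 3) * y)"
    by (rule tri_map_flip; (simp only: golden_norm)?;
      (linarith | (insert facts, simp only: golden_norm; linarith)))
  have s5: "tri_map ((2 - g) * y, g - 1 - (2 - g) * u + (2 * g - 3) * y) =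
      (2 - g - (2 * g - 3) * u - (2 * g - 3) * y, g - 1 + (2 * g - 3) * u - (2 - g) * y)"
    by (rule tri_map_skew; (simp only: golden_norm)?;
      (linarith | (insert facts, simp only: golden_norm; linarith)))
  show ?thesis
    by (simp only: funpow_unroll s1 s2 s3 s4 s5)
qed

definition shrink :: "real \<times> real \<Rightarrow> real \<times> real" where
  "shrink = (\<lambda>(u, y). ((2 - g) * u, (2 - g) * y))"

definition tip_point :: "real \<times> real \<Rightarrow> real \<times> real" where
  "tip_point = (\<lambda>(u, y). wedge_point ((2 * g - 3) * u, (2 * g - 3) * y))"

lemma tri_map_in_tri: "p \<in> tri \<Longrightarrow> tri_map p \<in> tri"
proof -
  assume p: "p \<in> tri"
  obtain u y where uy: "p = (u, y)" by (cases p)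
  have h: "0 < u" "g * u < y" "y \<le> 1" using p uy by (auto simp: tri_def)
  show ?thesis
  proof (cases "g * y < 1 + u")
    case True
    show ?thesis unfolding uy tri_map_skew[OF True refl refl] tri_def
      using skew_stays_in_tri[OF h True] by blast
  next
    case False
    then have b: "1 + u \<le> g * y" by simp
    show ?thesis unfolding uy tri_map_flip[OF b refl refl] tri_def
      using flip_stays_in_tri[OF h b] by blast
  qed
qed

lemma tri_map_self_similar: "speeds_up tri_map tri tri_map shrink"
proof -
  have "\<exists>n\<ge>1. (tri_map ^^ n) (shrink p) = shrink (tri_map p)" if p: "p \<in> tri" for p
  proof -
    obtain u y where uy: "p = (u, y)" by (cases p)
    have h: "0 < u" "g * u < y" "y \<le> 1" using p uy by (auto simp: tri_def)
    show ?thesis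
    proof (cases "g * y < 1 + u")
      case True
      have "(tri_map ^^ 3) (shrink p) = shrink (tri_map p)"
        using shrink_word_skew[OF h True]
          unfolding uy tri_map_skew[OF True refl refl] shrink_def prod.case
        by (simp only: golden_norm; simp)
      then show ?thesis by (metis one_le_numeral)
    next
      case False
      then have b: "1 + u \<le> g * y" by simp
      have "(tri_map ^^ 5) (shrink p) = shrink (tri_map p)"
        using shrink_word_flip[OF h b]
          unfolding uy tri_map_flip[OF b refl refl] shrink_def prod.case
        by (simp only: golden_norm; simp)
      then show ?thesis by (metis one_le_numeral)
    qed
  qed
  then show ?thesis unfolding speeds_up_def using tri_map_in_tri by blast
qed

lemma tri_map_correct: "speeds_up tri_map tri T_map tip_point"
proof -
  have "\<exists>n\<ge>1. (T_map ^^ n) (tip_point p) = tip_point (tri_map p)" if p: "p \<in> tri" for p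
  proof -
    obtain u y where uy: "p = (u, y)" by (cases p)
    have h: "0 < u" "g * u < y" "y \<le> 1" using p uy by (auto simp: tri_def)
    let ?w = "((2 * g - 3) * u, (2 * g - 3) * y)"
    have "(2 * g - 3) * u + (2 * g - 3) * y \<le> 1"
    proof -
      have "0 < (g - 1) * u" using h(1) golden_bounds by simp
      then have "u < 1" using h(2,3) unfolding left_diff_distrib by linarith
      then have "(2 * g - 3) * (u + y) \<le> (2 * g - 3) * 2"
        using h(3) golden_bounds by (intro mult_left_mono) auto
      moreover have "(2 * g - 3) * 2 \<le> 1" using golden_bounds by simp
      ultimately show ?thesis by (simp only: distrib_left)
    qed
    moreover have "0 < (2 * g - 3) * u" using h(1) golden_bounds by simp
    moreover have "g * ((2 * g - 3) * u) < (2 * g - 3) * y"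
      using golden_less(4)[OF h(2)] by (simp add: mult.left_commute)
    ultimately have w: "?w \<in> wedge" by (simp add: wedge_def)
    have "\<exists>n\<ge>1. (wedge_return ^^ n) ?w =
        (case tri_map p of (u, y) \<Rightarrow> ((2 * g - 3) * u, (2 * g - 3) * y))"
    proof (cases "g * y < 1 + u")
      case True
      have "(wedge_return ^^ 6) ?w =
          (case tri_map p of (u, y) \<Rightarrow> ((2 * g - 3) * u, (2 * g - 3) * y))"
        using tip_word_skew[OF h True] unfolding uy tri_map_skew[OF True refl refl] prod.case
        by (simp only: golden_norm; simp)
      then show ?thesis by (metis one_le_numeral)
    next
      case False
      then have b: "1 + u \<le> g * y" by simp
      have "(wedge_return ^^ 5) ?w =
          (case tri_map p of (u, y) \<Rightarrow> ((2 * g - 3) * u, (2 * g - 3) * y))"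
        using tip_word_flip[OF h b] unfolding uy tri_map_flip[OF b refl refl] prod.case
        by (simp only: golden_norm; simp)
      then show ?thesis by (metis one_le_numeral)
    qed
    then obtain n where n: "n \<ge> 1" "wedge_point ((wedge_return ^^ n) ?w) = tip_point (tri_map p)"
      unfolding tip_point_def by (auto split: prod.splits)
    obtain m where "m \<ge> n" "(T_map ^^ m) (wedge_point ?w) = wedge_point ((wedge_return ^^ n) ?w)"
      using speeds_up_iterate[OF wedge_return_correct w] by blast
    then show ?thesis using n uy unfolding tip_point_def by (auto intro!: exI[of _ m])
  qed
  then show ?thesis unfolding speeds_up_def using tri_map_in_tri by blast
qed


section \<open>The algebraic conjugate of the dynamics\<close>

text \<open>The root of unity \<open>exp (i \<pi> / 5)\<close>. The conjugate of the invariant quadratic form of \<open>tri_map\<close> is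
\<open>u\<^sup>2 + g u y + y\<^sup>2\<close>, the squared modulus of \<open>u + y \<omega>\<close>. Hence in the coordinate \<open>u + y \<omega>\<close> the conjugated
pieces are multiplications by \<open>\<omega>\<^sup>2\<close> and \<open>\<omega>^-2\<close>, up to translations.\<close>

definition omega :: complex where
  "omega = Complex (g / 2) (sqrt (1 - (g / 2)\<^sup>2))"

text \<open>The automorphism is encoded as a relation: a point and its conjugate share their integer
coefficients. A map is conjugated by rewriting these coefficients.\<close>

definition conj_of :: "real \<times> real \<Rightarrow> complex \<Rightarrow> bool" where
  "conj_of p \<zeta> \<longleftrightarrow> (\<exists>(m :: int) (n :: int) (m' :: int) (n' :: int). p = (m + n * g, m' + n' * g) \<and>
     \<zeta> = of_real (m + n * (1 - g)) + of_real (m' + n' * (1 - g)) * omega)"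

lemma half_golden_le: "(g / 2)\<^sup>2 \<le> 6636 / 10000"
  using golden_bounds golden_square by (simp add: power2_eq_square)

lemma omega_square: "omega * omega = of_real g * omega - 1"
proof -
  have "(g / 2)\<^sup>2 \<le> 1" using half_golden_le by simp
  then have "sqrt (1 - (g / 2)\<^sup>2) * sqrt (1 - (g / 2)\<^sup>2) = 1 - (g / 2)\<^sup>2" by simp
  then show ?thesis
    by (simp add: omega_def complex_eq_iff power2_eq_square golden_square)
qed

lemma cmod_omega: "cmod omega = 1"
  using half_golden_le by (simp add: omega_def cmod_def)

lemma of_real_golden_square: "of_real g * of_real g = (of_real g + 1 :: complex)"
  using arg_cong[OF golden_square, of "of_real :: real \<Rightarrow> complex"] by simp

lemma cmod_one_minus_omega_square: "cmod (1 - omega * omega) \<ge> 1"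
proof -
  have "(cmod (1 - omega * omega))\<^sup>2 = (2 - g * (g / 2))\<^sup>2 + (g * sqrt (1 - (g / 2)\<^sup>2))\<^sup>2"
    unfolding omega_square cmod_power2 by (simp add: omega_def)
  also have "\<dots> = 3 - g"
    using half_golden_le by (simp add: power_mult_distrib power2_eq_square golden_norm;
      simp add: field_simps golden_norm)
  finally have "1\<^sup>2 \<le> (cmod (1 - omega * omega))\<^sup>2" using golden_bounds by simp
  then show ?thesis by (rule power2_le_imp_le) simp
qed

lemma conj_of_skew:
  assumes "conj_of p \<zeta>"
  shows "conj_of (skew 1 p) (omega * omega * \<zeta> + omega)"
proof -
  obtain m n m' n' :: int where p: "p = (m + n * g, m' + n' * g)"
    and \<zeta>: "\<zeta> = of_real (m + n * (1 - g)) + of_real (m' + n' * (1 - g)) * omega"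
    using assms unfolding conj_of_def by blast
  have expr: "omega * omega * (of_real U + of_real Y * omega) + omega
      = of_real (- U - g * Y) + of_real (1 + g * U + g * Y) * omega" for U Y
    using omega_square of_real_golden_square
    by (simp only: of_real_add of_real_mult of_real_diff of_real_minus of_real_1) algebra
  have "- (m + n * (1 - g)) - g * (m' + n' * (1 - g)) =
      of_int (n' - m' - m) + of_int (m' - n) * (1 - g)"
    and "1 + g * (m + n * (1 - g)) + g * (m' + n' * (1 - g)) =
      of_int (1 - n + m - n' + m') + of_int (- m - m') * (1 - g)"
    by (simp_all add: golden_norm)
  then have "omega * omega * \<zeta> + omega =
      of_real (of_int (n' - m' - m) + of_int (m' - n) * (1 - g)) +
      of_real (of_int (1 - n + m - n' + m') + of_int (- m - m') * (1 - g)) * omega"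
    unfolding \<zeta> expr by (simp only:)
  moreover have "skew 1 p = (of_int (n' - m' - m) + of_int (m' - n) * g,
      of_int (1 - n + m - n' + m') + of_int (- m - m') * g)"
    unfolding p skew_def by (simp add: golden_norm)
  ultimately show ?thesis unfolding conj_of_def by blast
qed

text \<open>The factor \<open>g * (1 - \<omega>)\<close> is \<open>\<omega>^-2\<close>.\<close>

lemma conj_of_flip:
  assumes "conj_of p \<zeta>"
  shows "conj_of (flip p) (of_real g * (1 - omega) * \<zeta> + (1 + of_real (1 - g) * omega))"
proof -
  obtain m n m' n' :: int where p: "p = (m + n * g, m' + n' * g)"
    and \<zeta>: "\<zeta> = of_real (m + n * (1 - g)) + of_real (m' + n' * (1 - g)) * omega"
    using assms unfolding conj_of_def by blast
  have expr: "of_real g * (1 - omega) * (of_real U + of_real Y * omega) + (1 +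
    of_real (1 - g) * omega)
      = of_real (1 + g * U + g * Y) + of_real (1 - g - g * U - Y) * omega" for U Y
    using omega_square of_real_golden_square
    by (simp only: of_real_add of_real_mult of_real_diff of_real_minus of_real_1) algebra
  have "1 + g * (m + n * (1 - g)) + g * (m' + n' * (1 - g)) =
      of_int (1 - n + m - n' + m') + of_int (- m - m') * (1 - g)"
    and "1 - g - g * (m + n * (1 - g)) - (m' + n' * (1 - g)) =
      of_int (n - m - m') + of_int (1 + m - n') * (1 - g)"
    by (simp_all add: golden_norm)
  then have "of_real g * (1 - omega) * \<zeta> + (1 + of_real (1 - g) * omega) =
      of_real (of_int (1 - n + m - n' + m') + of_int (- m - m') * (1 - g)) +
      of_real (of_int (n - m - m') + of_int (1 + m - n') * (1 - g)) * omega"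
    unfolding \<zeta> expr by (simp only:)
  moreover have "flip p = (of_int (1 - n + m - n' + m') + of_int (- m - m') * g,
      of_int (n - m - m') + of_int (1 + m - n') * g)"
    unfolding p flip_def by (simp add: golden_norm)
  ultimately show ?thesis unfolding conj_of_def by blast
qed

text \<open>Multiplication by \<open>g\<^sup>2 = g + 1\<close> is conjugate to multiplication by \<open>(1 - g)\<^sup>2 = 2 - g\<close>, which is \<open>g^-2\<close>.\<close>

lemma conj_of_expand:
  assumes "conj_of (u, y) \<zeta>"
  shows "conj_of ((g + 1) * u, (g + 1) * y) (of_real (2 - g) * \<zeta>)"
proof -
  obtain m n m' n' :: int where p: "u = m + n * g" "y = m' + n' * g"
    and \<zeta>: "\<zeta> = of_real (m + n * (1 - g)) + of_real (m' + n' * (1 - g)) * omega"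
    using assms unfolding conj_of_def by blast
  have "(2 - g) * (a + b * (1 - g)) = of_int (a + b) + of_int (a + 2 * b) * (1 - g)" for a b :: int
    by (simp add: golden_norm)
  then have "of_real (2 - g) * \<zeta> = of_real (of_int (m + n) + of_int (m + 2 * n) * (1 - g)) +
      of_real (of_int (m' + n') + of_int (m' + 2 * n') * (1 - g)) * omega"
    unfolding \<zeta> by (simp only: distrib_left mult.assoc[symmetric] of_real_mult[symmetric])
  moreover have "((g + 1) * u, (g + 1) * y) = (of_int (m + n) + of_int (m + 2 * n) * g,
      of_int (m' + n') + of_int (m' + 2 * n') * g)"
    unfolding p by (simp add: golden_norm)
  ultimately show ?thesis unfolding conj_of_def by blast
qed

text \<open>All iterates have the same distance from the fixed point \<open>\<beta> / (1 - \<rho>)\<close>, whose modulus is at most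
that of \<open>\<beta>\<close>.\<close>

lemma rotation_orbit_bounded:
  fixes \<rho> \<beta> \<zeta> :: complex
  assumes "cmod \<rho> = 1" "cmod (1 - \<rho>) \<ge> 1"
  shows "cmod (((\<lambda>z. \<rho> * z + \<beta>) ^^ k) \<zeta>) \<le> cmod \<zeta> + 2 * cmod \<beta>"
proof -
  define c where "c = \<beta> / (1 - \<rho>)"
  have "1 - \<rho> \<noteq> 0" using assms(2) by auto
  then have fix_c: "\<rho> * c + \<beta> = c" unfolding c_def by (simp add: field_simps)
  have c: "cmod c \<le> cmod \<beta>"
    unfolding c_def norm_divide using assms(2)
      by (simp add: divide_le_eq mult_left_le_one_le mult_le_cancel_left1)
  have "cmod (((\<lambda>z. \<rho> * z + \<beta>) ^^ k) \<zeta> - c) = cmod (\<zeta> - c)"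
  proof (induction k)
    case (Suc k)
    let ?z = "((\<lambda>z. \<rho> * z + \<beta>) ^^ k) \<zeta>"
    have "\<rho> * ?z + \<beta> - c = \<rho> * (?z - c)" using fix_c by (simp add: algebra_simps)
    then show ?case using Suc assms(1) by (simp add: norm_mult)
  qed simp
  then show ?thesis
    using norm_triangle_ineq2[of "((\<lambda>z. \<rho> * z + \<beta>) ^^ k) \<zeta>" c] norm_triangle_ineq4[of \<zeta> c] c
    by linarith
qed

text \<open>An element \<open>m + n g\<close> and its conjugate differ by \<open>n \<surd>5\<close>. If the element lies strictly between \<open>0\<close> and
\<open>g^-1\<close> and its conjugate is smaller than \<open>g\<^sup>2\<close> in modulus, then \<open>n\<close> is \<open>-1\<close>, \<open>0\<close> or \<open>1\<close>, and no integer
\<open>m\<close> fits. So the conjugate of \<open>u\<close> is at least \<open>g\<^sup>2\<close>, which bounds the distance of \<open>\<zeta>\<close> from the line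
through \<open>\<omega>\<close>.\<close>

lemma conj_of_far:
  assumes "conj_of (u, y) \<zeta>" and u: "0 < u" "u < g - 1"
  shows "3 / 2 \<le> cmod \<zeta>"
proof -
  obtain m n m' n' :: int where um: "u = m + n * g"
    and \<zeta>: "\<zeta> = of_real (m + n * (1 - g)) + of_real (m' + n' * (1 - g)) * omega"
    using assms unfolding conj_of_def by blast
  define U where "U = m + n * (1 - g)"
  have diff: "u - U = n * (2 * g - 1)" unfolding um U_def by (simp add: algebra_simps)
  have far: "g + 1 \<le> \<bar>U\<bar>"
  proof (rule ccontr)
    assume "\<not> g + 1 \<le> \<bar>U\<bar>"
    then have U: "\<bar>U\<bar> < g + 1" by simp
    have "\<bar>n\<bar> * (2 * g - 1) < 2 * (2 * g - 1)"
    proof -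
      have "\<bar>n\<bar> * (2 * g - 1) = \<bar>u - U\<bar>" unfolding diff using golden_bounds by (simp add: abs_mult)
      also have "\<dots> \<le> u + \<bar>U\<bar>" using abs_triangle_ineq4[of u U] u(1) by simp
      also have "\<dots> < 4 * g - 2" using U u golden_bounds by linarith
      also have "\<dots> = 2 * (2 * g - 1)" by simp
      finally show ?thesis .
    qed
    then have "real_of_int \<bar>n\<bar> < 2"
      by (rule mult_right_less_imp_less) (use golden_bounds in simp)
    then consider "n = 0" | "n = 1" | "n = -1" by linarith
    then show False
    proof cases
      case 1
      then have "0 < m" "real_of_int m < 1" using u golden_bounds unfolding um by auto
      then show False by simp
    next
      case 2
      then have "0 < real_of_int (m + 2)"
        "real_of_int (m + 1) < 0" using u golden_bounds unfolding um by auto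
      then show False unfolding of_int_0_less_iff of_int_less_0_iff by linarith
    next
      case 3
      then have "0 < real_of_int (m - 1)"
        "real_of_int (m - 3) < 0" using u golden_bounds unfolding um by auto
      then have "m = 2" unfolding of_int_0_less_iff of_int_less_0_iff by linarith
      then show False using U 3 golden_bounds unfolding U_def by simp
    qed
  qed
  have im: "58 / 100 \<le> Im omega"
  proof -
    have "(58 / 100)\<^sup>2 = (1 - 6636 / 10000 :: real)" by (simp add: power2_eq_square)
    then have "58 / 100 \<le> sqrt (1 - (g / 2)\<^sup>2)"
      using half_golden_le by (intro real_le_rsqrt) linarith
    then show ?thesis by (simp add: omega_def)
  qed
  \<comment> \<open>Rotating \<open>\<omega>\<close> to the real axis leaves only the contribution of \<open>U\<close> in the imaginary part.\<close>
  have "Im (\<zeta> * cnj omega) = - U * Im omega"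
    unfolding \<zeta> U_def by (simp add: algebra_simps)
  then have "\<bar>U\<bar> * Im omega \<le> cmod (\<zeta> * cnj omega)"
    using abs_Im_le_cmod[of "\<zeta> * cnj omega"] im by (simp add: abs_mult)
  also have "\<dots> = cmod \<zeta>" using cmod_omega by (simp add: norm_mult)
  finally have "\<bar>U\<bar> * Im omega \<le> cmod \<zeta>" .
  moreover have "(g + 1) * (58 / 100) \<le> \<bar>U\<bar> * Im omega"
    using far im golden_bounds by (intro mult_mono) auto
  ultimately show ?thesis using golden_bounds by simp
qed

definition expand :: "real \<times> real \<Rightarrow> real \<times> real" where
  "expand = (\<lambda>(u, y). ((g + 1) * u, (g + 1) * y))"

lemma shrink_expand: "shrink (expand p) = p"
proof (cases p)
  case (Pair u y)
  have "(2 - g) * ((g + 1) * x) = x" for x by (simp only: golden_norm; simp)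
  then show ?thesis unfolding Pair shrink_def expand_def by simp
qed

lemma expand_in_tri:
  assumes "(u, y) \<in> tri" "(g + 1) * y \<le> 1"
  shows "expand (u, y) \<in> tri"
proof -
  have "0 < u" "g * u < y" using assms by (auto simp: tri_def)
  then have "0 < (g + 1) * u" "(g + 1) * (g * u) < (g + 1) * y" using golden_bounds by simp_all
  then show ?thesis using assms(2) unfolding expand_def tri_def by (simp add: mult.left_commute)
qed

lemma funpow_semiconj:
  assumes "\<And>p z. R p z \<Longrightarrow> R (f p) (h z)" "R p z"
  shows "R ((f ^^ k) p) ((h ^^ k) z)"
  using assms by (induction k) auto

text \<open>An orbit that does not close up changes pieces, hence meets the shrunken triangle. Up to then its
conjugate has followed powers of a single rotation and possibly one further step. The total
displacement is at most \<open>2\<close>, or \<open>2 / g + 1 < 2.24\<close>, according to the first piece. Expanding by \<open>g\<^sup>2\<close>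
divides the conjugate by \<open>g\<^sup>2\<close>.\<close>

lemma renormalization:
  assumes p: "p \<in> tri" and conj: "conj_of p \<zeta>"
  shows "eventually_periodic tri_map p \<or> (\<exists>k q \<zeta>'. q \<in> tri \<and> (tri_map ^^ k) p = shrink q \<and>
    conj_of q \<zeta>' \<and> cmod \<zeta>' \<le> (2 - g) * (cmod \<zeta> + 224 / 100))"
proof -
  let ?a = "\<lambda>z. omega * omega * z + omega"
  let ?b = "\<lambda>z. of_real g * (1 - omega) * z + (1 + of_real (1 - g) * omega)"
  have in_tri: "(tri_map ^^ k) p \<in> tri" for k
    using tri_map_in_tri p by (induction k) auto
  have renormalize: ?thesis if q: "(tri_map ^^ k) p = (u, y)" "(g + 1) * y \<le> 1"
    and \<zeta>': "conj_of (u, y) \<zeta>'" "cmod \<zeta>' \<le> cmod \<zeta> + 224 / 100" for k u y \<zeta>'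
  proof -
    have "expand (u, y) \<in> tri" using expand_in_tri[OF _ q(2)] in_tri[of k] q(1) by simp
    moreover have "(tri_map ^^ k) p = shrink (expand (u, y))" using q(1)
      by (simp add: shrink_expand)
    moreover have "conj_of (expand (u, y)) (of_real (2 - g) * \<zeta>')"
      using conj_of_expand[OF \<zeta>'(1)] by (simp add: expand_def)
    moreover have "cmod (of_real (2 - g) * \<zeta>') \<le> (2 - g) * (cmod \<zeta> + 224 / 100)"
      unfolding norm_mult norm_of_real using \<zeta>'(2) golden_bounds by (auto intro!: mult_mono)
    ultimately show ?thesis by blast
  qed
  have cmod_a: "cmod (omega * omega) = 1" using cmod_omega by (simp add: norm_mult)
  have inverse: "of_real g * (1 - omega) * (omega * omega) = 1"
    using omega_square of_real_golden_square by algebra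
  have cmod_b: "cmod (of_real g * (1 - omega)) = 1"
    using arg_cong[OF inverse, of cmod] cmod_a by (simp add: norm_mult)
  \<comment> \<open>The two rotations are inverse to each other, so both are equally far from the identity.\<close>
  have "1 - of_real g * (1 - omega) = - (of_real g * (1 - omega)) * (1 - omega * omega)"
    using inverse by (simp add: algebra_simps)
  then have far_b: "1 \<le> cmod (1 - of_real g * (1 - omega))"
    using cmod_b cmod_one_minus_omega_square by (simp add: norm_mult)
  have shift_b: "cmod (1 + of_real (1 - g) * omega) \<le> 62 / 100"
  proof -
    have "(cmod (1 + of_real (1 - g) * omega))\<^sup>2 =
        (1 + (1 - g) * (g / 2))\<^sup>2 + ((1 - g) * sqrt (1 - (g / 2)\<^sup>2))\<^sup>2"
      unfolding cmod_power2 by (simp add: omega_def)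
    also have "\<dots> = 2 - g"
      using half_golden_le by (simp add: power_mult_distrib power2_eq_square golden_norm;
        simp add: field_simps golden_norm)
    finally have "(cmod (1 + of_real (1 - g) * omega))\<^sup>2 \<le> (62 / 100)\<^sup>2"
      using golden_bounds by (simp add: power2_eq_square)
    then show ?thesis by (rule power2_le_imp_le) simp
  qed
  have bound_a: "cmod ((?a ^^ k) z) \<le> cmod z + 2" for k z
    using rotation_orbit_bounded[OF cmod_a cmod_one_minus_omega_square, where \<beta> = omega
      and k = k and \<zeta> = z] cmod_omega by simp
  have bound_b: "cmod ((?b ^^ k) z) \<le> cmod z + 124 / 100" for k z
    using rotation_orbit_bounded[OF cmod_b far_b, where \<beta> = "1 + of_real (1 - g) * omega"
      and k = k and \<zeta> = z] shift_b by simp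
  have conj_a: "conj_of ((skew 1 ^^ k) p) ((?a ^^ k) \<zeta>)" for k
    by (rule funpow_semiconj[where R = conj_of, OF conj_of_skew conj])
  have conj_b: "conj_of ((flip ^^ k) p) ((?b ^^ k) \<zeta>)" for k
    by (rule funpow_semiconj[where R = conj_of, OF conj_of_flip conj])
  define Sa where "Sa = {(u, y). (u, y) \<in> tri \<and> g * y < 1 + u}"
  define Sb where "Sb = {(u, y). (u, y) \<in> tri \<and> 1 + u \<le> g * y}"
  have ret_a: "tri_map q = skew 1 q" if "q \<in> Sa" for q
    using that unfolding Sa_def tri_map_def by auto
  have ret_b: "tri_map q = flip q" if "q \<in> Sb" for q
    using that unfolding Sb_def tri_map_def by auto
  show ?thesis
  proof (cases "p \<in> Sa")
    case True
    have "eventually_periodic tri_map p \<or> (\<exists>k. (tri_map ^^ k) p = (skew 1 ^^ k) p \<and>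
        (tri_map ^^ k) p \<in> Sa \<and> (tri_map ^^ Suc k) p \<notin> Sa)"
      by (rule cycle_or_exit[OF _ skew_order _ True]) (erule ret_a, simp)
    then show ?thesis
    proof (elim disjE exE conjE)
      fix k assume k: "(tri_map ^^ k) p =
          (skew 1 ^^ k) p" "(tri_map ^^ k) p \<in> Sa" "(tri_map ^^ Suc k) p \<notin> Sa"
      obtain u y where uy: "(tri_map ^^ k) p = (u, y)" by fastforce
      have h: "0 < u" "g * u < y" "y \<le> 1" "g * y < 1 + u" using k(2) uy
        by (auto simp: Sa_def tri_def)
      have "(tri_map ^^ Suc k) p = (- u + (g - 1) * y, 1 - (g - 1) * u - (g - 1) * y)"
        using uy tri_map_skew[OF h(4) refl refl] by simp
      then have "\<not> g * (1 - (g - 1) * u - (g - 1) * y) < 1 + (- u + (g - 1) * y)"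
        using k(3) in_tri[of "Suc k"] unfolding Sa_def by simp
      then have "(g + 1) * y \<le> 1" using skew_then_flip_low[OF h] by simp
      then show ?thesis
        using renormalize[OF uy, of "(?a ^^ k) \<zeta>"] conj_a[of k] bound_a[of k \<zeta>] k(1) uy by simp
    qed simp
  next
    case False
    then have b: "p \<in> Sb" using p unfolding Sa_def Sb_def by auto
    have "eventually_periodic tri_map p \<or> (\<exists>k. (tri_map ^^ k) p = (flip ^^ k) p \<and>
        (tri_map ^^ k) p \<in> Sb \<and> (tri_map ^^ Suc k) p \<notin> Sb)"
      by (rule cycle_or_exit[OF _ flip_order _ b]) (erule ret_b, simp)
    then show ?thesis
    proof (elim disjE exE conjE)
      fix k assume k: "(tri_map ^^ k) p =
          (flip ^^ k) p" "(tri_map ^^ k) p \<in> Sb" "(tri_map ^^ Suc k) p \<notin> Sb"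
      obtain u y where uy: "(tri_map ^^ k) p = (u, y)" by fastforce
      have h: "0 < u" "g * u < y" "y \<le> 1" "1 + u \<le> g * y" using k(2) uy
        by (auto simp: Sb_def tri_def)
      let ?v = "1 - (g - 1) * u - (g - 1) * y" and ?z = "g + (g - 1) * u - y"
      have flip: "flip (u, y) = (?v, ?z)" by (simp add: flip_def)
      have next_k: "(tri_map ^^ Suc k) p = (?v, ?z)"
        using uy tri_map_flip[OF h(4) refl refl] by simp
      then have v: "g * ?z < 1 + ?v"
        using k(3) in_tri[of "Suc k"] unfolding Sb_def by simp
      let ?w = "- ?v + (g - 1) * ?z" and ?x = "1 - (g - 1) * ?v - (g - 1) * ?z"
      have step: "(tri_map ^^ Suc (Suc k)) p = (?w, ?x)"
        using next_k tri_map_skew[OF v refl refl] by simp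
      have "(g + 1) * ?x \<le> 1" using flip_then_skew_low[OF h v] by (simp add: golden_norm)
      moreover have "conj_of (?w, ?x) (?a ((?b ^^ Suc k) \<zeta>))"
      proof -
        have "(flip ^^ Suc k) p = (?v, ?z)" using k(1) uy flip by simp
        moreover have "skew 1 (?v, ?z) = (?w, ?x)" by (simp only: skew_def prod.case)
        ultimately show ?thesis using conj_of_skew[OF conj_b[of "Suc k"]] by (simp only:)
      qed
      moreover have "cmod (?a ((?b ^^ Suc k) \<zeta>)) \<le> cmod \<zeta> + 224 / 100"
        using norm_triangle_ineq[of "omega * omega * (?b ^^ Suc k) \<zeta>" omega] bound_b[of "Suc k" \<zeta>]
          cmod_a cmod_omega by (simp add: norm_mult del: funpow.simps)
      ultimately show ?thesis using renormalize[OF step] by blast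
    qed simp
  qed
qed

lemma far_of_tri:
  assumes "p \<in> tri" "conj_of p \<zeta>"
  shows "3 / 2 \<le> cmod \<zeta>"
proof -
  obtain u y where uy: "p = (u, y)" by (cases p)
  have h: "0 < u" "g * u < 1" using assms(1) uy by (auto simp: tri_def)
  have "(g - 1) * (g * u) < (g - 1) * 1" using h(2) golden_bounds
    by (intro mult_strict_left_mono) auto
  then have "u < g - 1" by (simp add: golden_inverse mult.assoc[symmetric])
  then show ?thesis using conj_of_far[OF _ h(1)] assms(2) uy by simp
qed

text \<open>By the lower bound \<open>3/2\<close> each renormalization decreases the modulus of the conjugate by at least
\<open>1/20\<close>, because \<open>0.382 * (t + 2.24) \<le> t - 0.05\<close> for \<open>t \<ge> 3/2\<close>. So only finitely many can take place,
and periodicity is transported back through them.\<close>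

lemma tri_eventually_periodic:
  assumes "p \<in> tri" "conj_of p \<zeta>"
  shows "eventually_periodic tri_map p"
proof -
  have "cmod \<zeta> \<le> real n / 20 \<Longrightarrow> p \<in> tri \<Longrightarrow> conj_of p \<zeta> \<Longrightarrow> eventually_periodic tri_map p" for n p \<zeta>
  proof (induction n arbitrary: p \<zeta>)
    case (0 p \<zeta>)
    show ?case using far_of_tri[OF 0(2,3)] 0(1) by simp
  next
    case (Suc n p \<zeta>)
    show ?case
    proof (rule disjE[OF renormalization[OF Suc(3,4)]])
      assume "\<exists>k q \<zeta>'. q \<in> tri \<and> (tri_map ^^ k) p = shrink q \<and>
        conj_of q \<zeta>' \<and> cmod \<zeta>' \<le> (2 - g) * (cmod \<zeta> + 224 / 100)"
      then obtain k q \<zeta>' where q: "q \<in> tri" "(tri_map ^^ k) p = shrink q" "conj_of q \<zeta>'"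
        and \<zeta>': "cmod \<zeta>' \<le> (2 - g) * (cmod \<zeta> + 224 / 100)" by blast
      have "(2 - g) * (cmod \<zeta> + 224 / 100) \<le> (382 / 1000) * (cmod \<zeta> + 224 / 100)"
        using golden_bounds by (intro mult_right_mono) auto
      then have "cmod \<zeta>' \<le> real n / 20"
        using \<zeta>' far_of_tri[OF Suc(3,4)] Suc(2) by simp
      then have "eventually_periodic tri_map q" using Suc.IH q by blast
      then have "eventually_periodic tri_map ((tri_map ^^ k) p)"
        using speeds_up_eventually_periodic[OF tri_map_self_similar q(1)] q(2) by simp
      then show ?thesis by (rule eventually_periodic_before)
    qed
  qed
  moreover have "cmod \<zeta> \<le> real (nat \<lceil>20 * cmod \<zeta>\<rceil>) / 20"
    using real_nat_ceiling_ge[of "20 * cmod \<zeta>"] by linarith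
  ultimately show ?thesis using assms by blast
qed

section \<open>Points with coordinates in the ring of the golden ratio\<close>

definition golden_ring :: "real set" where
  "golden_ring = {x. \<exists>(m :: int) (n :: int). x = m + n * g}"

lemma golden_ringI: "x = of_int m + of_int n * g \<Longrightarrow> x \<in> golden_ring"
  unfolding golden_ring_def by blast

lemma golden_ring_of_int: "of_int m \<in> golden_ring"
  by (rule golden_ringI[of _ m 0]) simp

lemma golden_ring_golden: "g \<in> golden_ring"
  by (rule golden_ringI[of _ 0 1]) simp

lemma golden_ring_add: "x \<in> golden_ring \<Longrightarrow> y \<in> golden_ring \<Longrightarrow> x + y \<in> golden_ring"
proof -
  assume "x \<in> golden_ring" "y \<in> golden_ring"
  then obtain m n m' n' :: int where "x = m + n * g" "y = m' + n' * g"
    unfolding golden_ring_def by blast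
  then show ?thesis by (intro golden_ringI[of _ "m + m'" "n + n'"]) (simp add: algebra_simps)
qed

lemma golden_ring_mult: "x \<in> golden_ring \<Longrightarrow> y \<in> golden_ring \<Longrightarrow> x * y \<in> golden_ring"
proof -
  assume "x \<in> golden_ring" "y \<in> golden_ring"
  then obtain m n m' n' :: int where "x = m + n * g" "y = m' + n' * g"
    unfolding golden_ring_def by blast
  then show ?thesis
    by (intro golden_ringI[of _ "m * m' + n * n'" "m * n' + n * m' + n * n'"])
      (simp add: golden_norm)
qed

lemma golden_ring_minus: "x \<in> golden_ring \<Longrightarrow> - x \<in> golden_ring"
  using golden_ring_mult[OF golden_ring_of_int[of "-1"], of x] by simp

lemma golden_ring_diff: "x \<in> golden_ring \<Longrightarrow> y \<in> golden_ring \<Longrightarrow> x - y \<in> golden_ring"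
  using golden_ring_add[OF _ golden_ring_minus, of x y] by simp

lemma golden_ring_numeral: "numeral k \<in> golden_ring"
  using golden_ring_of_int[of "numeral k"] by simp

lemma golden_ring_1: "1 \<in> golden_ring"
  using golden_ring_of_int[of 1] by simp

lemmas golden_ring_closed = golden_ring_add golden_ring_mult golden_ring_minus golden_ring_diff
  golden_ring_numeral golden_ring_1 golden_ring_golden

lemma int_adjoin_golden_ring: "int_adjoin g \<subseteq> golden_ring"
proof -
  have "poly (map_poly of_int p) g \<in> golden_ring" for p :: "int poly"
  proof (induction p)
    case 0
    show ?case using golden_ring_of_int[of 0] by simp
  next
    case (pCons a p)
    then show ?case
      by (simp add: map_poly_pCons golden_ring_add golden_ring_mult golden_ring_of_int golden_ring_golden)
  qed
  then show ?thesis unfolding int_adjoin_def by auto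
qed

lemma T_map_golden_ring:
  assumes "z \<in> golden_ring \<times> golden_ring"
  shows "(T_map ^^ n) z \<in> golden_ring \<times> golden_ring"
proof (induction n)
  case (Suc n)
  then show ?case
    by (cases "(T_map ^^ n) z")
      (auto simp: T_map_def frac_def divide_golden intro!: golden_ring_closed golden_ring_of_int)
qed (use assms in simp)

lemma wedge_return_golden_ring:
  assumes "p \<in> golden_ring \<times> golden_ring"
  shows "(wedge_return ^^ n) p \<in> golden_ring \<times> golden_ring"
proof (induction n)
  case (Suc n)
  then show ?case
    by (cases "(wedge_return ^^ n) p")
      (auto simp: wedge_return_def skew_def intro!: golden_ring_closed)
qed (use assms in simp)

lemma conj_of_golden_ring: "p \<in> golden_ring \<times> golden_ring \<Longrightarrow> \<exists>\<zeta>. conj_of p \<zeta>"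
  unfolding conj_of_def golden_ring_def by auto


section \<open>From the square to the wedge\<close>

abbreviation square :: "(real \<times> real) set" where
  "square \<equiv> {0..<1} \<times> {0..<1}"

lemma T_map_square: "z \<in> square \<Longrightarrow> (T_map ^^ n) z \<in> square"
proof (induction n)
  case (Suc n)
  then show ?case using bij_betw_apply[OF T_map_bij_betw] by simp
qed simp

lemma T_map_inj: "inj_on T_map square"
  using T_map_bij_betw by (rule bij_betw_imp_inj_on)

text \<open>On the square the map is injective, so a preperiod can be cancelled.\<close>

lemma eventually_periodic_imp_periodic:
  assumes z: "z \<in> square" and "eventually_periodic T_map z"
  shows "\<exists>m\<ge>1. (T_map ^^ m) z = z"
proof -
  obtain k m where m: "m \<ge> 1" "(T_map ^^ (m + k)) z = (T_map ^^ k) z"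
    using assms(2) unfolding eventually_periodic_def by blast
  have "(T_map ^^ (m + k)) z = (T_map ^^ k) z \<Longrightarrow> (T_map ^^ m) z = z"
  proof (induction k)
    case (Suc k)
    then have "T_map ((T_map ^^ (m + k)) z) = T_map ((T_map ^^ k) z)" by simp
    then have "(T_map ^^ (m + k)) z = (T_map ^^ k) z"
      by (rule inj_onD[OF T_map_inj]) (use T_map_square[OF z] in blast)+
    then show ?case by (rule Suc.IH)
  qed simp
  then show ?thesis using m by blast
qed

text \<open>Both pieces are rotated with order ten, so a point that is not eventually periodic changes pieces
again and again. The crossing from the upper to the lower piece is the entry to the wedge. The origin
is a third piece of its own, as \<open>- x - y / g\<close> is already an integer there.\<close>

lemma square_reaches_wedge:
  assumes z: "z \<in> square"
  shows "eventually_periodic T_map z \<or> (\<exists>n p. p \<in> wedge \<and> (T_map ^^ n) z = wedge_point p)"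
proof -
  define S1 where "S1 = {(x, y). (x, y) \<in> square \<and> 0 < x + (g - 1) * y \<and> x + (g - 1) * y \<le> 1}"
  define S2 where "S2 = {(x, y). (x, y) \<in> square \<and> 1 < x + (g - 1) * y}"
  have range: "x + (g - 1) * y < 2" if "(x, y) \<in> square" for x y
  proof -
    have "x < 1" "(g - 1) * y \<le> g - 1"
      using that golden_bounds by (auto intro!: mult_left_le)
    then show ?thesis using golden_bounds by linarith
  qed
  have T1: "T_map w = turn 1 w" if "w \<in> S1" for w
  proof -
    obtain x y where w: "w = (x, y)" by (cases w)
    have "0 < x + (g - 1) * y" "x + (g - 1) * y \<le> 1" using that unfolding w S1_def by auto
    then show ?thesis using T_step[of 1 x y] unfolding w turn_def by simp
  qed
  have T2: "T_map w = turn 2 w" if "w \<in> S2" for w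
  proof -
    obtain x y where w: "w = (x, y)" by (cases w)
    have "1 < x + (g - 1) * y"
      "x + (g - 1) * y < 2" using that range[of x y] unfolding w S2_def by auto
    then show ?thesis using T_step[of 2 x y] unfolding w turn_def by simp
  qed
  have cover: "w = (0, 0) \<or> w \<in> S1 \<or> w \<in> S2" if "w \<in> square" for w
  proof -
    obtain x y where w: "w = (x, y)" by (cases w)
    have xy: "0 \<le> x" "0 \<le> y" using that w by auto
    then have gy: "0 \<le> (g - 1) * y" using golden_bounds by simp
    show ?thesis
    proof (cases "x + (g - 1) * y \<le> 0")
      case True
      then have "x = 0" "(g - 1) * y = 0" using xy gy by linarith+
      then show ?thesis using w golden_bounds by simp
    next
      case False
      then show ?thesis using that unfolding w S1_def S2_def by auto
    qed
  qed
  have origin: "eventually_periodic T_map (0, 0)"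
    using eventually_periodicI[of 1 T_map "(0, 0)"] by (simp add: T_map_def)
  have from_S2: ?thesis if k: "(T_map ^^ k) z \<in> S2" for k
  proof -
    let ?w = "(T_map ^^ k) z"
    have "eventually_periodic T_map ?w \<or> (\<exists>j. (T_map ^^ j) ?w = (turn 2 ^^ j) ?w \<and>
        (T_map ^^ j) ?w \<in> S2 \<and> (T_map ^^ Suc j) ?w \<notin> S2)"
      by (rule cycle_or_exit[OF _ turn_order _ k]) (erule T2, simp)
    then show ?thesis
    proof (elim disjE exE conjE)
      fix j assume j: "(T_map ^^ j) ?w \<in> S2" "(T_map ^^ Suc j) ?w \<notin> S2"
      have orbit: "(T_map ^^ (k + i)) z = (T_map ^^ i) ?w" for i
        by (rule funpow_trans[OF refl refl])
      obtain x y where xy: "(T_map ^^ j) ?w = (x, y)" by fastforce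
      let ?q = "2 - x - (g - 1) * y"
      have s: "1 < x + (g - 1) * y" "x < 1" using j(1) unfolding xy S2_def by auto
      have image: "(T_map ^^ Suc j) ?w = (y, ?q)" using T2[OF j(1)] xy by (simp add: turn_def)
      have "(y, ?q) \<in> square"
        using T_map_square[OF z, of "k + Suc j"] image orbit[of "Suc j"] by simp
      then have le: "y + (g - 1) * ?q \<le> 1" using j(2) unfolding image S2_def by simp
      let ?p = "(g * (?q - 1) + y, g * y)"
      have point: "wedge_point ?p = (y, ?q)"
        unfolding wedge_point_def prod.case by (simp only: prod.inject golden_norm; simp)
      have "0 < g * (1 - x)" using s(2) golden_bounds by simp
      moreover have "g * (1 - x) = g * (?q - 1) + y" by (simp only: golden_norm)
      ultimately have 1: "0 < g * (?q - 1) + y" by (simp only:)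
      have "0 < (g + 1) * (x + (g - 1) * y - 1)" using s(1) golden_bounds by simp
      moreover have "(g + 1) * (x + (g - 1) * y - 1) = g * y - g * (g * (?q - 1) + y)"
        by (simp only: golden_norm)
      ultimately have 2: "g * (g * (?q - 1) + y) < g * y" by linarith
      have "0 \<le> (g + 1) * (1 - (y + (g - 1) * ?q))" using le golden_bounds by simp
      moreover have "(g + 1) * (1 - (y + (g - 1) * ?q)) = 1 - (g * (?q - 1) + y + g * y)"
        by (simp only: golden_norm)
      ultimately have 3: "g * (?q - 1) + y + g * y \<le> 1" by linarith
      from 1 2 3 have "?p \<in> wedge" unfolding wedge_def by blast
      moreover have "(T_map ^^ (k + Suc j)) z = wedge_point ?p"
        using orbit[of "Suc j"] image point by (simp only:)
      ultimately show ?thesis by blast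
    qed (rule disjI1, erule eventually_periodic_before)
  qed
  show ?thesis
  proof (cases "z \<in> S1")
    case True
    have "eventually_periodic T_map z \<or> (\<exists>j. (T_map ^^ j) z = (turn 1 ^^ j) z \<and>
        (T_map ^^ j) z \<in> S1 \<and> (T_map ^^ Suc j) z \<notin> S1)"
      by (rule cycle_or_exit[OF _ turn_order _ True]) (erule T1, simp)
    then show ?thesis
    proof (elim disjE exE conjE)
      fix j assume "(T_map ^^ Suc j) z \<notin> S1"
      then have "(T_map ^^ Suc j) z = (0, 0) \<or> (T_map ^^ Suc j) z \<in> S2"
        using cover[OF T_map_square[OF z]] by blast
      then show ?thesis
        using from_S2 origin eventually_periodic_before[of T_map "Suc j" z] by metis
    qed simp
  next
    case False
    then have "z = (0, 0) \<or> (T_map ^^ 0) z \<in> S2" using cover[OF z] by simp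
    then show ?thesis using from_S2 origin by metis
  qed
qed

lemma golden_ring_eventually_periodic:
  assumes z: "z \<in> square" and ring: "z \<in> golden_ring \<times> golden_ring"
  shows "eventually_periodic T_map z"
proof (rule disjE[OF square_reaches_wedge[OF z]])
  assume "\<exists>n p. p \<in> wedge \<and> (T_map ^^ n) z = wedge_point p"
  then obtain n p where p: "p \<in> wedge" "(T_map ^^ n) z = wedge_point p" by blast
  have "p \<in> golden_ring \<times> golden_ring"
  proof -
    obtain u y where uy: "p = (u, y)" by (cases p)
    have "((g - 1) * y, 1 + (g - 1) * u - (2 - g) * y) \<in> golden_ring \<times> golden_ring"
      using T_map_golden_ring[OF ring, of n] p(2) unfolding uy wedge_point_def by simp
    then have *: "(g - 1) * y \<in> golden_ring" "1 + (g - 1) * u - (2 - g) * y \<in> golden_ring" by auto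
    \<comment> \<open>The coding by \<open>wedge_point\<close> is inverted over the ring.\<close>
    note golden_ring_mult[OF golden_ring_golden *(1)]
      golden_ring_add[OF golden_ring_mult[OF
        golden_ring_golden golden_ring_diff[OF *(2) golden_ring_1]] *(1)]
    moreover have "g * ((g - 1) * y) = y"
      "g * (1 + (g - 1) * u - (2 - g) * y - 1) + (g - 1) * y = u"
      by (simp only: golden_norm; simp)+
    ultimately show ?thesis unfolding uy by simp
  qed
  then have ring_p: "(wedge_return ^^ k) p \<in> golden_ring \<times> golden_ring" for k
    by (rule wedge_return_golden_ring)
  have "settles p" using p(1) by (rule wedge_settles)
  then have "eventually_periodic T_map (wedge_point p)"
    unfolding settles_def
  proof (elim disjE exE)
    assume "eventually_periodic wedge_return p"
    then show ?thesis by (rule speeds_up_eventually_periodic[OF wedge_return_correct p(1)])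
  next
    fix k assume k: "(wedge_return ^^ k) p \<in> tip"
    obtain u y where uy: "(wedge_return ^^ k) p = (u, y)" by fastforce
    define q where "q = ((2 * g + 1) * u, (2 * g + 1) * y)"
    have h: "0 < u" "g * u < y" "(2 * g + 1) * y \<le> 1" using k uy by (auto simp: tip_def)
    then have "0 < (2 * g + 1) * u"
      "(2 * g + 1) * (g * u) < (2 * g + 1) * y" using golden_bounds by simp_all
    then have "q \<in> tri" using h(3) unfolding q_def tri_def by (simp add: mult.left_commute)
    moreover have "q \<in> golden_ring \<times> golden_ring"
      using ring_p[of k] unfolding uy q_def by (auto intro!: golden_ring_closed)
    ultimately have "eventually_periodic tri_map q"
      using tri_eventually_periodic conj_of_golden_ring by blast
    then have "eventually_periodic T_map (tip_point q)"
      by (rule speeds_up_eventually_periodic[OF tri_map_correct \<open>q \<in> tri\<close>])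
    moreover have "tip_point q = wedge_point (u, y)"
    proof -
      have "(2 * g - 3) * ((2 * g + 1) * x) = x" for x by (simp only: golden_norm; simp)
      then show ?thesis by (simp only: q_def tip_point_def prod.case)
    qed
    moreover obtain m where "(T_map ^^ m) (wedge_point p) = wedge_point (u, y)"
      using speeds_up_iterate[OF wedge_return_correct p(1), of k] uy by auto
    ultimately show ?thesis using eventually_periodic_before[of T_map m] by simp
  qed
  then show ?thesis using p(2) eventually_periodic_before[of T_map n z] by simp
qed

section \<open>An aperiodic point\<close>

text \<open>The renormalizations of the exceptional point, in cyclic order.\<close>

definition cycle_points :: "(real \<times> real) set" where
  "cycle_points = {(1/3 * g, 1), (2/3 - 1/3 * g, 1/3 + 1/3 * g), (1/3, 2/3), (-1/3 + 1/3 * g, 1)}"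

lemma shrinkI: "p = (2 - g) * u \<Longrightarrow> q = (2 - g) * y \<Longrightarrow> shrink (u, y) = (p, q)"
  by (simp add: shrink_def)

lemma cycle_points_in_tri:
  assumes "w \<in> cycle_points"
  shows "w \<in> tri"
proof -
  have "(0 :: real) < 1/3 * g" "g * (1/3 * g) < 1" "1 \<le> (1 :: real)"
    by ((simp only: golden_norm)?; (linarith | (insert golden_bounds, linarith)))+
  then have 1: "(1/3 * g, 1) \<in> tri" by (simp add: tri_def)
  have "(0 :: real) < 2/3 - 1/3 * g" "g * (2/3 - 1/3 * g) < 1/3 + 1/3 * g"
    "1/3 + 1/3 * g \<le> (1 :: real)"
    by ((simp only: golden_norm)?; (linarith | (insert golden_bounds, linarith)))+
  then have 2: "(2/3 - 1/3 * g, 1/3 + 1/3 * g) \<in> tri" by (simp add: tri_def)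
  have "(0 :: real) < 1/3" "g * (1/3) < 2/3" "2/3 \<le> (1 :: real)"
    by ((simp only: golden_norm)?; (linarith | (insert golden_bounds, linarith)))+
  then have 3: "(1/3, 2/3) \<in> tri" by (simp add: tri_def)
  have "(0 :: real) < -1/3 + 1/3 * g" "g * (-1/3 + 1/3 * g) < 1" "1 \<le> (1 :: real)"
    by ((simp only: golden_norm)?; (linarith | (insert golden_bounds, linarith)))+
  then have 4: "(-1/3 + 1/3 * g, 1) \<in> tri" by (simp add: tri_def)
  show ?thesis using assms 1 2 3 4 unfolding cycle_points_def by blast
qed

lemma cycle_points_renormalize:
  assumes "w \<in> cycle_points"
  shows "\<exists>k. \<exists>w'\<in>cycle_points. (tri_map ^^ k) w = shrink w'"
proof -
  have x1: "tri_map (1/3 * g, 1) = (5/3 - g, -2/3 + g)"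
    by (rule tri_map_flip; (simp only: golden_norm)?; (linarith | (insert golden_bounds, linarith)))
  have x2: "tri_map (5/3 - g, -2/3 + g) = (2 - g, -2 + 5/3 * g)"
    by (rule tri_map_flip; (simp only: golden_norm)?; (linarith | (insert golden_bounds, linarith)))
  have x3: "tri_map (2 - g, -2 + 5/3 * g) = (5/3 - g, 1/3)"
    by (rule tri_map_skew; (simp only: golden_norm)?; (linarith | (insert golden_bounds, linarith)))
  have "shrink (2/3 - 1/3 * g, 1/3 + 1/3 * g) = (5/3 - g, 1/3)"
    by (rule shrinkI; (simp only: golden_norm)?; (linarith | (insert golden_bounds, linarith)))
  then have 1: "(tri_map ^^ 3) (1/3 * g, 1) = shrink (2/3 - 1/3 * g, 1/3 + 1/3 * g)"
    using x1 x2 x3 by (simp only: funpow_unroll)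
  have y1: "tri_map (2/3 - 1/3 * g, 1/3 + 1/3 * g) = (2 - g, -4/3 + 4/3 * g)"
    by (rule tri_map_flip; (simp only: golden_norm)?; (linarith | (insert golden_bounds, linarith)))
  have y2: "tri_map (2 - g, -4/3 + 4/3 * g) = (2/3 - 1/3 * g, 4/3 - 2/3 * g)"
    by (rule tri_map_skew; (simp only: golden_norm)?; (linarith | (insert golden_bounds, linarith)))
  have "shrink (1/3, 2/3) = (2/3 - 1/3 * g, 4/3 - 2/3 * g)"
    by (rule shrinkI; (simp only: golden_norm)?; (linarith | (insert golden_bounds, linarith)))
  then have 2: "(tri_map ^^ 2) (2/3 - 1/3 * g, 1/3 + 1/3 * g) = shrink (1/3, 2/3)"
    using y1 y2 by (simp only: funpow_unroll)
  have z1: "tri_map (1/3, 2/3) = (-1 + 2/3 * g, 2 - g)"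
    by (rule tri_map_skew; (simp only: golden_norm)?; (linarith | (insert golden_bounds, linarith)))
  have "shrink (-1/3 + 1/3 * g, 1) = (-1 + 2/3 * g, 2 - g)"
    by (rule shrinkI; (simp only: golden_norm)?; (linarith | (insert golden_bounds, linarith)))
  then have 3: "(tri_map ^^ 1) (1/3, 2/3) = shrink (-1/3 + 1/3 * g, 1)"
    using z1 by (simp only: funpow_unroll)
  have w1: "tri_map (-1/3 + 1/3 * g, 1) = (4/3 - 2/3 * g, -1/3 + 2/3 * g)"
    by (rule tri_map_flip; (simp only: golden_norm)?; (linarith | (insert golden_bounds, linarith)))
  have w2: "tri_map (4/3 - 2/3 * g, -1/3 + 2/3 * g) = (-1/3 + 1/3 * g, 2 - g)"
    by (rule tri_map_skew; (simp only: golden_norm)?; (linarith | (insert golden_bounds, linarith)))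
  have "shrink (1/3 * g, 1) = (-1/3 + 1/3 * g, 2 - g)"
    by (rule shrinkI; (simp only: golden_norm)?; (linarith | (insert golden_bounds, linarith)))
  then have 4: "(tri_map ^^ 2) (-1/3 + 1/3 * g, 1) = shrink (1/3 * g, 1)"
    using w1 w2 by (simp only: funpow_unroll)
  show ?thesis
    using assms 1 2 3 4 unfolding cycle_points_def by blast
qed

text \<open>The point enters the wedge after two steps and then reaches the tip by the letters D, B and A.\<close>

lemma special_point_orbit:
  "\<exists>n. (T_map ^^ n) (1/3 + 1/3 * g, 11/3 - 5/3 * g) = tip_point (shrink (1/3 * g, 1))"
proof -
  have t1: "(T_map ^^ 1) (1/3 + 1/3 * g, 11/3 - 5/3 * g) = (11/3 - 5/3 * g, 7 - 4 * g)"
    by (rule T_rotation1[where b = 2]; (simp only: golden_norm Ints_1 Ints_numeral)?;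
      (linarith | (insert golden_bounds, linarith))?)
  have t2: "(T_map ^^ 1) (11/3 - 5/3 * g, 7 - 4 * g) = (7 - 4 * g, 28/3 - 16/3 * g)"
    by (rule T_rotation1[where b = 2]; (simp only: golden_norm Ints_1 Ints_numeral)?;
      (linarith | (insert golden_bounds, linarith))?)
  have w: "wedge_point (5/3 - g, -4 + 3 * g) = (7 - 4 * g, 28/3 - 16/3 * g)"
    unfolding wedge_point_def prod.case prod.inject
      by (intro conjI; simp only: golden_norm; linarith)
  have p_in: "(5/3 - g, -4 + 3 * g) \<in> wedge"
    unfolding wedge_def mem_Collect_eq prod.case by (intro conjI;
      (simp only: golden_norm)?; (linarith | (insert golden_bounds, linarith)))
  have r1: "wedge_return (5/3 - g, -4 + 3 * g) = (5 - 3 * g, -22/3 + 5 * g)"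
    by (rule wedge_return_D; (simp only: golden_norm)?;
      (linarith | (insert golden_bounds, linarith)))
  have r2: "wedge_return (5 - 3 * g, -22/3 + 5 * g) = (-3 + 2 * g, 16/3 - 3 * g)"
    by (rule wedge_return_B; (simp only: golden_norm)?;
      (linarith | (insert golden_bounds, linarith)))
  have r3: "wedge_return (-3 + 2 * g, 16/3 - 3 * g) = (-16/3 + 10/3 * g, 7/3 - 4/3 * g)"
    by (rule wedge_return_A; (simp only: golden_norm)?;
      (linarith | (insert golden_bounds, linarith)))
  have "(wedge_return ^^ 3) (5/3 - g, -4 + 3 * g) = (-16/3 + 10/3 * g, 7/3 - 4/3 * g)"
    using r1 r2 r3 by (simp only: funpow_unroll)
  moreover have "tip_point (4/3 - 2/3 * g, -1/3 + 2/3 * g) =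
      wedge_point (-16/3 + 10/3 * g, 7/3 - 4/3 * g)"
    unfolding tip_point_def prod.case
      by (rule arg_cong[where f = wedge_point]; unfold prod.inject; intro conjI;
        simp only: golden_norm; linarith)
  ultimately obtain n where n: "(T_map ^^ n) (wedge_point (5/3 - g, -4 + 3 * g)) =
      tip_point (4/3 - 2/3 * g, -1/3 + 2/3 * g)"
    using speeds_up_iterate[OF wedge_return_correct p_in, of 3] by auto
  have "tri_map (4/3 - 2/3 * g, -1/3 + 2/3 * g) = (-1/3 + 1/3 * g, 2 - g)"
    by (rule tri_map_skew; (simp only: golden_norm)?; (linarith | (insert golden_bounds, linarith)))
  moreover have "shrink (1/3 * g, 1) = (-1/3 + 1/3 * g, 2 - g)"
    by (rule shrinkI; (simp only: golden_norm)?; (linarith | (insert golden_bounds, linarith)))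
  ultimately have a: "tri_map (4/3 - 2/3 * g, -1/3 + 2/3 * g) = shrink (1/3 * g, 1)" by (simp only:)
  have "(4/3 - 2/3 * g, -1/3 + 2/3 * g) \<in> tri"
    unfolding tri_def mem_Collect_eq prod.case by (intro conjI; (simp only: golden_norm)?;
      (linarith | (insert golden_bounds, linarith)))
  then obtain m where "(T_map ^^ m) (tip_point (4/3 - 2/3 * g, -1/3 + 2/3 * g)) =
      tip_point (shrink (1/3 * g, 1))"
    using speeds_up_iterate[OF tri_map_correct, of "(4/3 - 2/3 * g, -1/3 + 2/3 * g)" 1]
      unfolding funpow_unroll a by blast
  then show ?thesis
    using funpow_trans[OF t1 funpow_trans[OF t2[folded w] funpow_trans[OF n]]] unfolding w by blast
qed

lemma shrink_tri: "p \<in> tri \<Longrightarrow> shrink p \<in> tri"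
proof -
  assume p: "p \<in> tri"
  obtain u y where uy: "p = (u, y)" by (cases p)
  have h: "0 < u" "g * u < y" "y \<le> 1" using p uy by (auto simp: tri_def)
  have "0 < g * u" using h(1) golden_bounds by simp
  then have y_pos: "0 < y" using h(2) by linarith
  have "0 < (2 - g) * u" "(2 - g) * (g * u) < (2 - g) * y" using h golden_bounds by simp_all
  moreover have "(2 - g) * y \<le> 1"
    using mult_mono[of "2 - g" 1 y 1] h(3) golden_bounds order.strict_implies_order[OF y_pos]
      by simp
  ultimately show ?thesis unfolding uy shrink_def tri_def by (simp add: mult.left_commute)
qed

text \<open>The renormalizations are composed by transporting each of them into the shrunken triangle with the
self-similarity. The orbit thus visits points of every scale.\<close>

lemma cycle_points_orbit:
  assumes "w \<in> cycle_points"
  shows "\<exists>k. \<exists>w'\<in>cycle_points. (tri_map ^^ k) w = (shrink ^^ n) w'"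
  using assms
proof (induction n arbitrary: w)
  case 0
  then show ?case by (auto intro: exI[of _ 0])
next
  case (Suc n)
  obtain k v where v: "v \<in> cycle_points" "(tri_map ^^ k) w = shrink v"
    using cycle_points_renormalize[OF Suc.prems] by blast
  obtain m w' where w': "w' \<in> cycle_points" "(tri_map ^^ m) v = (shrink ^^ n) w'"
    using Suc.IH[OF v(1)] by blast
  obtain j where "(tri_map ^^ j) (shrink v) = shrink ((tri_map ^^ m) v)"
    using speeds_up_iterate[OF tri_map_self_similar cycle_points_in_tri[OF v(1)], of m] by blast
  then have "(tri_map ^^ (k + j)) w = (shrink ^^ Suc n) w'"
    using funpow_trans[OF v(2), of j] w'(2) by simp
  then show ?case using w'(1) by blast
qed

lemma snd_shrink: "snd ((shrink ^^ n) p) = (2 - g) ^ n * snd p"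
  by (induction n) (simp_all add: shrink_def case_prod_beta)

text \<open>The first coordinate of \<open>tip_point\<close> is proportional to \<open>y\<close>, so the orbit has positive first coordinates
that tend to zero. A periodic orbit is finite and has a smallest positive first coordinate.\<close>

lemma orbit_through_cycle_aperiodic:
  fixes z :: "real \<times> real"
  assumes z: "(T_map ^^ a) z = tip_point (shrink w)" and w: "w \<in> cycle_points" and m: "m \<ge> 1"
  shows "(T_map ^^ m) z \<noteq> z"
proof
  assume per: "(T_map ^^ m) z = z"
  have small: "\<exists>n. 0 < fst ((T_map ^^ n) z) \<and> fst ((T_map ^^ n) z) \<le> (2 - g) ^ i" for i
  proof -
    obtain k v where v: "v \<in> cycle_points" "(tri_map ^^ k) w = (shrink ^^ i) v"
      using cycle_points_orbit[OF w] by blast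
    have w_tri: "w \<in> tri" by (rule cycle_points_in_tri[OF w])
    obtain j where j: "(tri_map ^^ j) (shrink w) = shrink ((shrink ^^ i) v)"
      using speeds_up_iterate[OF tri_map_self_similar w_tri, of k] v(2) by auto
    obtain n where "(T_map ^^ n) (tip_point (shrink w)) = tip_point ((shrink ^^ Suc i) v)"
      using speeds_up_iterate[OF tri_map_correct shrink_tri[OF w_tri], of j] j by auto
    then have "(T_map ^^ (a + n)) z = tip_point ((shrink ^^ Suc i) v)"
      by (rule funpow_trans[OF z])
    moreover have "fst (tip_point p) = (g - 1) * (2 * g - 3) * snd p" for p
      by (simp add: tip_point_def wedge_point_def case_prod_beta)
    ultimately have fst: "fst ((T_map ^^ (a + n)) z) =
        (g - 1) * (2 * g - 3) * ((2 - g) ^ Suc i * snd v)"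
      by (simp only: snd_shrink)
    have v01: "0 < snd v" "snd v \<le> 1"
    proof -
      obtain u y where uy: "v = (u, y)" by (cases v)
      have h: "0 < u" "g * u < y" "y \<le> 1" using cycle_points_in_tri[OF v(1)] uy
        by (auto simp: tri_def)
      moreover have "0 < g * u" using h(1) golden_bounds by simp
      ultimately show "0 < snd v" "snd v \<le> 1" using uy by auto
    qed
    have "0 < fst ((T_map ^^ (a + n)) z)" unfolding fst using v01 golden_bounds by simp
    moreover have "fst ((T_map ^^ (a + n)) z) \<le> 1 * 1 * ((2 - g) ^ i * 1)"
      unfolding fst power_Suc using v01 golden_bounds
      by (intro mult_mono) (auto intro!: mult_left_le_one_le)
    ultimately show ?thesis by auto
  qed
  let ?S = "{x \<in> (\<lambda>n. fst ((T_map ^^ n) z)) ` {..<m}. 0 < x}"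
  have mod: "(T_map ^^ n) z = (T_map ^^ (n mod m)) z" for n
    using funpow_mod_eq[OF per, of n] by simp
  have in_S: "x \<in> ?S" if "x = fst ((T_map ^^ n) z)" "0 < x" for x n
    using that mod[of n] m by (auto intro!: image_eqI[of _ _ "n mod m"])
  have fin: "finite ?S" by simp
  have "?S \<noteq> {}" using small[of 0] in_S by blast
  then have "0 < Min ?S" using Min_in[OF fin] by blast
  then obtain i where i: "(2 - g) ^ i < Min ?S"
    using real_arch_pow_inv[of "Min ?S" "2 - g"] golden_bounds by auto
  obtain n where n: "0 < fst ((T_map ^^ n) z)" "fst ((T_map ^^ n) z) \<le> (2 - g) ^ i"
    using small by blast
  then have "Min ?S \<le> fst ((T_map ^^ n) z)" using in_S[OF refl n(1)] fin by (intro Min_le) auto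
  then show False using i n(2) by linarith
qed


section \<open>Periodic and aperiodic points\<close>

theorem theorem8p2:
  "(\<forall>z \<in> (int_adjoin golden_ratio \<inter> {0..<1}) \<times> (int_adjoin golden_ratio \<inter> {0..<1}).
      min_period T_map z < \<infinity>) \<and>
   min_period T_map (1 - 1 / (3 * golden_ratio ^ 2), 1 - 1 / (3 * golden_ratio ^ 5)) = \<infinity>"
proof (intro conjI ballI)
  fix z :: "real \<times> real"
  assume z: "z \<in> (int_adjoin g \<inter> {0..<1}) \<times> (int_adjoin g \<inter> {0..<1})"
  then have "z \<in> square" and "z \<in> golden_ring \<times> golden_ring"
    using int_adjoin_golden_ring by auto
  then have "\<exists>m\<ge>1. (T_map ^^ m) z = z"
    using eventually_periodic_imp_periodic golden_ring_eventually_periodic by blast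
  then show "min_period T_map z < \<infinity>" unfolding min_period_def by auto
next
  let ?z = "(1 / 3 + 1 / 3 * g, 11 / 3 - 5 / 3 * g)"
  have pow: "g ^ 2 = g + 1" "g ^ 5 = 5 * g + 3"
  proof -
    show "g ^ 2 = g + 1" by (simp add: power2_eq_square golden_square)
    have "g ^ 5 = g * (g * (g * (g * g)))" by (simp add: eval_nat_numeral)
    also have "\<dots> = 5 * g + 3" by (simp only: golden_norm; simp)
    finally show "g ^ 5 = 5 * g + 3" .
  qed
  have third: "1 / (3 * a) = b / 3" if "a * b = 1" for a b :: real
  proof -
    have "a \<noteq> 0" using that by auto
    have "1 / (3 * a) = (a * b) / (3 * a)" using that by simp
    also have "\<dots> = b / 3" using \<open>a \<noteq> 0\<close> by simp
    finally show ?thesis .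
  qed
  have "1 / (3 * (g + 1)) = (2 - g) / 3" by (rule third) (simp only: golden_norm; simp)
  moreover have "1 / (3 * (5 * g + 3)) = (5 * g - 8) / 3"
    by (rule third) (simp only: golden_norm; simp)
  ultimately have eq: "(1 - 1 / (3 * g ^ 2), 1 - 1 / (3 * g ^ 5)) = ?z"
    unfolding pow by (simp add: field_simps)
  obtain n where "(T_map ^^ n) ?z = tip_point (shrink (1 / 3 * g, 1))"
    using special_point_orbit by blast
  moreover have "(1 / 3 * g, 1) \<in> cycle_points" by (simp add: cycle_points_def)
  ultimately have "\<not> (\<exists>p\<ge>1. (T_map ^^ p) ?z = ?z)" using orbit_through_cycle_aperiodic by blast
  then show "min_period T_map (1 - 1 / (3 * g ^ 2), 1 - 1 / (3 * g ^ 5)) = \<infinity>"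
    unfolding eq min_period_def by simp
qed


end
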